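(* Let $\mathcal{Y}$ and $\mathcal{Z}$ be length abelian categories and let $F:\mathcal{Z}\to\mathcal{Y}$ be a right exact functor. Let $\mathcal{E}_{\mathcal{Y}}\subset\mathcal{Y}$ and $\mathcal{E}_{\mathcal{Z}}\subset\mathcal{Z}$ be subcategories, and let $\mathcal{E}_{\mathcal{X}}$ be the full subcategory of $\mathcal{Y}\rtimes_{F}\mathcal{Z}$ consisting of the objects of the form $(Z,Y,f)$ with $Z\in\mathcal{E}_{\mathcal{Z}}$ and $Y\in\mathcal{E}_{\mathcal{Y}}$. Then $\mathcal{E}_{\mathcal{Y}}$ and $\mathcal{E}_{\mathcal{Z}}$ are left Schur (respectively wide, torsion-free) if and only if $\mathcal{E}_{\mathcal{X}}$ is left Schur (respectively wide, torsion-free).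
   Context: A length abelian category is an abelian category in which every object has finite length. "Subcategory" means a full subcategory closed under isomorphisms and containing the zero object. The category $\mathcal{Y}\rtimes_{F}\mathcal{Z}$ (the MacPherson–Vilonen construction for the natural transformation $F\to 0$): objects are triples $(Z,Y,f)$ with $Z\in\mathcal{Z}$, $Y\in\mathcal{Y}$ and $f:FZ\to Y$ a morphism in $\mathcal{Y}$; morphisms $(Z,Y,f)\to(Z',Y',f')$ are pairs $(z,y)$ with $z:Z\to Z'$ in $\mathcal{Z}$, $y:Y\to Y'$ in $\mathcal{Y}$ and $y f=f'\circ F(z)$. It is an abelian category. Let $\mathcal{A}$ be a length abelian category and $\mathcal{E}$ a subcategory. $\mathcal{E}$ is extension-closed (closed under extensions) in $\mathcal{A}$ if for every short exact sequence $0\to X\to Y\to Z\to 0$ in $\mathcal{A}$ with $X,Z\in\mathcal{E}$ one has $Y\in\mathcal{E}$. If $\mathcal{E}$ is extension-closed, a non-zero object $M\in\mathcal{E}$ is a simple object in $\mathcal{E}$ if there is no short exact sequence $0\to L\to M\to N\to 0$ in $\mathcal{A}$ with $L,M,N\in\mathcal{E}$ and $L,N\neq 0$. A non-zero object $M\in\mathcal{A}$ is left Schurian for a collection $\mathcal{C}$ of objects of $\mathcal{A}$ if every morphism $M\to C$ with $C\in\mathcal{C}$ is either zero or an injection (monomorphism) in $\mathcal{A}$. $\mathcal{E}$ is left Schur if it is extension-closed in $\mathcal{A}$ and every simple object in $\mathcal{E}$ is left Schurian for $\mathcal{E}$. $\mathcal{E}$ is wide if it is closed under extensions, kernels and cokernels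 in $\mathcal{A}$ (for every morphism $f$ in $\mathcal{E}$, $\operatorname{Ker} f$ and $\operatorname{Coker} f$ lie in $\mathcal{E}$). $\mathcal{E}$ is torsion-free (a torsion-free class) if it is closed under extensions and subobjects in $\mathcal{A}$. *)

theory Defs
  imports "HOL-Algebra.Group"
begin

section \<open>Categories with an addition on arrows\<close>

text \<open>Objects and arrows form carrier sets. Every arrow determines its domain and codomain, so the
  hom-sets are disjoint; composition is written in the order of functions.
  The operations matter only on arguments for which the mathematical operation makes sense.\<close>

record ('o, 'a) precat =
  Obj :: "'o set"
  Arr :: "'a set"
  Dom :: "'a \<Rightarrow> 'o"
  Cod :: "'a \<Rightarrow> 'o"
  Id :: "'o \<Rightarrow> 'a"
  Comp :: "'a \<Rightarrow> 'a \<Rightarrow> 'a"  (infixl "\<cdot>\<index>" 70)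
  Add :: "'a \<Rightarrow> 'a \<Rightarrow> 'a"
  Zero :: "'o \<Rightarrow> 'o \<Rightarrow> 'a"

definition Hom :: "('o, 'a) precat \<Rightarrow> 'o \<Rightarrow> 'o \<Rightarrow> 'a set" where
  "Hom C X Y = {f \<in> Arr C. Dom C f = X \<and> Cod C f = Y}"

definition Hom_group :: "('o, 'a) precat \<Rightarrow> 'o \<Rightarrow> 'o \<Rightarrow> 'a monoid" where
  "Hom_group C X Y = \<lparr>carrier = Hom C X Y, monoid.mult = Add C, one = Zero C X Y\<rparr>"

locale category =
  fixes C :: "('o, 'a) precat"
  assumes Dom_in: "f \<in> Arr C \<Longrightarrow> Dom C f \<in> Obj C"
    and Cod_in: "f \<in> Arr C \<Longrightarrow> Cod C f \<in> Obj C"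
    and Id_in: "X \<in> Obj C \<Longrightarrow> Id C X \<in> Hom C X X"
    and Comp_in: "f \<in> Hom C X Y \<Longrightarrow> g \<in> Hom C Y Z \<Longrightarrow> g \<cdot>\<^bsub>C\<^esub> f \<in> Hom C X Z"
    and Comp_Id: "f \<in> Hom C X Y \<Longrightarrow> f \<cdot>\<^bsub>C\<^esub> Id C X = f"
    and Id_Comp: "f \<in> Hom C X Y \<Longrightarrow> Id C Y \<cdot>\<^bsub>C\<^esub> f = f"
    and Comp_assoc: "f \<in> Hom C W X \<Longrightarrow> g \<in> Hom C X Y \<Longrightarrow> h \<in> Hom C Y Z \<Longrightarrow>
      (h \<cdot>\<^bsub>C\<^esub> g) \<cdot>\<^bsub>C\<^esub> f = h \<cdot>\<^bsub>C\<^esub> (g \<cdot>\<^bsub>C\<^esub> f)"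

locale preadditive_category = category +
  assumes Hom_comm_group: "X \<in> Obj C \<Longrightarrow> Y \<in> Obj C \<Longrightarrow> comm_group (Hom_group C X Y)"
    and Comp_Add: "f \<in> Hom C X Y \<Longrightarrow> f' \<in> Hom C X Y \<Longrightarrow> g \<in> Hom C Y Z \<Longrightarrow>
      g \<cdot>\<^bsub>C\<^esub> Add C f f' = Add C (g \<cdot>\<^bsub>C\<^esub> f) (g \<cdot>\<^bsub>C\<^esub> f')"
    and Add_Comp: "f \<in> Hom C X Y \<Longrightarrow> g \<in> Hom C Y Z \<Longrightarrow> g' \<in> Hom C Y Z \<Longrightarrow>
      Add C g g' \<cdot>\<^bsub>C\<^esub> f = Add C (g \<cdot>\<^bsub>C\<^esub> f) (g' \<cdot>\<^bsub>C\<^esub> f)"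

definition zero_object :: "('o, 'a) precat \<Rightarrow> 'o \<Rightarrow> bool" where
  "zero_object C X \<longleftrightarrow> X \<in> Obj C \<and>
     (\<forall>Y \<in> Obj C. (\<exists>!f. f \<in> Hom C X Y) \<and> (\<exists>!f. f \<in> Hom C Y X))"

definition monic :: "('o, 'a) precat \<Rightarrow> 'a \<Rightarrow> bool" where
  "monic C f \<longleftrightarrow> f \<in> Arr C \<and>
     (\<forall>W \<in> Obj C. \<forall>g \<in> Hom C W (Dom C f). \<forall>h \<in> Hom C W (Dom C f).
        f \<cdot>\<^bsub>C\<^esub> g = f \<cdot>\<^bsub>C\<^esub> h \<longrightarrow> g = h)"

definition epic :: "('o, 'a) precat \<Rightarrow> 'a \<Rightarrow> bool" where
  "epic C f \<longleftrightarrow> f \<in> Arr C \<and>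
     (\<forall>W \<in> Obj C. \<forall>g \<in> Hom C (Cod C f) W. \<forall>h \<in> Hom C (Cod C f) W.
        g \<cdot>\<^bsub>C\<^esub> f = h \<cdot>\<^bsub>C\<^esub> f \<longrightarrow> g = h)"

definition iso_arrow :: "('o, 'a) precat \<Rightarrow> 'a \<Rightarrow> bool" where
  "iso_arrow C f \<longleftrightarrow> f \<in> Arr C \<and>
     (\<exists>g \<in> Hom C (Cod C f) (Dom C f).
        g \<cdot>\<^bsub>C\<^esub> f = Id C (Dom C f) \<and> f \<cdot>\<^bsub>C\<^esub> g = Id C (Cod C f))"

text \<open>\<open>is_kernel C k f\<close>: the arrow \<open>k\<close> is a kernel of \<open>f\<close>;
  \<open>is_cokernel C q f\<close>: the arrow \<open>q\<close> is a cokernel of \<open>f\<close>.\<close>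

definition is_kernel :: "('o, 'a) precat \<Rightarrow> 'a \<Rightarrow> 'a \<Rightarrow> bool" where
  "is_kernel C k f \<longleftrightarrow> f \<in> Arr C \<and> k \<in> Arr C \<and> Cod C k = Dom C f \<and>
     f \<cdot>\<^bsub>C\<^esub> k = Zero C (Dom C k) (Cod C f) \<and>
     (\<forall>W \<in> Obj C. \<forall>h \<in> Hom C W (Dom C f). f \<cdot>\<^bsub>C\<^esub> h = Zero C W (Cod C f) \<longrightarrow>
        (\<exists>!u. u \<in> Hom C W (Dom C k) \<and> k \<cdot>\<^bsub>C\<^esub> u = h))"

definition is_cokernel :: "('o, 'a) precat \<Rightarrow> 'a \<Rightarrow> 'a \<Rightarrow> bool" where
  "is_cokernel C q f \<longleftrightarrow> f \<in> Arr C \<and> q \<in> Arr C \<and> Dom C q = Cod C f \<and>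
     q \<cdot>\<^bsub>C\<^esub> f = Zero C (Dom C f) (Cod C q) \<and>
     (\<forall>W \<in> Obj C. \<forall>h \<in> Hom C (Cod C f) W. h \<cdot>\<^bsub>C\<^esub> f = Zero C (Dom C f) W \<longrightarrow>
        (\<exists>!u. u \<in> Hom C (Cod C q) W \<and> u \<cdot>\<^bsub>C\<^esub> q = h))"

definition short_exact :: "('o, 'a) precat \<Rightarrow> 'a \<Rightarrow> 'a \<Rightarrow> bool" where
  "short_exact C f g \<longleftrightarrow> is_kernel C f g \<and> is_cokernel C g f"

definition biproduct ::
    "('o, 'a) precat \<Rightarrow> 'o \<Rightarrow> 'o \<Rightarrow> 'o \<Rightarrow> 'a \<Rightarrow> 'a \<Rightarrow> 'a \<Rightarrow> 'a \<Rightarrow> bool" where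
  "biproduct C X Y P i j p q \<longleftrightarrow> P \<in> Obj C \<and>
     i \<in> Hom C X P \<and> j \<in> Hom C Y P \<and> p \<in> Hom C P X \<and> q \<in> Hom C P Y \<and>
     p \<cdot>\<^bsub>C\<^esub> i = Id C X \<and> q \<cdot>\<^bsub>C\<^esub> j = Id C Y \<and>
     p \<cdot>\<^bsub>C\<^esub> j = Zero C Y X \<and> q \<cdot>\<^bsub>C\<^esub> i = Zero C X Y \<and>
     Add C (i \<cdot>\<^bsub>C\<^esub> p) (j \<cdot>\<^bsub>C\<^esub> q) = Id C P"

locale abelian_category = preadditive_category +
  assumes zero_ex: "\<exists>X. zero_object C X"
    and biproduct_ex: "X \<in> Obj C \<Longrightarrow> Y \<in> Obj C \<Longrightarrow> \<exists>P i j p q. biproduct C X Y P i j p q"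
    and kernel_ex: "f \<in> Arr C \<Longrightarrow> \<exists>k. is_kernel C k f"
    and cokernel_ex: "f \<in> Arr C \<Longrightarrow> \<exists>q. is_cokernel C q f"
    and monic_normal: "monic C f \<Longrightarrow> \<exists>g. is_kernel C f g"
    and epic_normal: "epic C f \<Longrightarrow> \<exists>g. is_cokernel C f g"

definition simple_object :: "('o, 'a) precat \<Rightarrow> 'o \<Rightarrow> bool" where
  "simple_object C S \<longleftrightarrow> S \<in> Obj C \<and> \<not> zero_object C S \<and>
     (\<forall>m. monic C m \<and> Cod C m = S \<longrightarrow> zero_object C (Dom C m) \<or> iso_arrow C m)"

text \<open>An object has finite length if it has a composition series
  \<open>0 = M\<^sub>0 \<rightarrow> M\<^sub>1 \<rightarrow> \<dots> \<rightarrow> M\<^sub>n = X\<close>, where \<open>i k : M\<^sub>k \<rightarrow> M\<^sub>k\<^sub>+\<^sub>1\<close>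
  are inclusions and \<open>p k\<close> the projections onto the simple factors.\<close>

definition finite_length :: "('o, 'a) precat \<Rightarrow> 'o \<Rightarrow> bool" where
  "finite_length C X \<longleftrightarrow>
     (\<exists>(n::nat) M i p. zero_object C (M 0) \<and> M n = X \<and>
        (\<forall>k<n. i k \<in> Hom C (M k) (M (Suc k)) \<and> short_exact C (i k) (p k) \<and>
               simple_object C (Cod C (p k))))"

locale length_abelian_category = abelian_category +
  assumes finite_length: "X \<in> Obj C \<Longrightarrow> finite_length C X"


section \<open>Right exact functors\<close>

record ('o, 'a, 'p, 'b) cfunctor =
  FObj :: "'o \<Rightarrow> 'p"
  FArr :: "'a \<Rightarrow> 'b"

locale additive_functor = C: preadditive_category C + D: preadditive_category D
  for C :: "('o, 'a) precat" and D :: "('p, 'b) precat" +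
  fixes F :: "('o, 'a, 'p, 'b) cfunctor"
  assumes FObj_in: "X \<in> Obj C \<Longrightarrow> FObj F X \<in> Obj D"
    and FArr_in: "f \<in> Hom C X Y \<Longrightarrow> FArr F f \<in> Hom D (FObj F X) (FObj F Y)"
    and FArr_Id: "X \<in> Obj C \<Longrightarrow> FArr F (Id C X) = Id D (FObj F X)"
    and FArr_Comp: "f \<in> Hom C X Y \<Longrightarrow> g \<in> Hom C Y Z \<Longrightarrow>
      FArr F (g \<cdot>\<^bsub>C\<^esub> f) = FArr F g \<cdot>\<^bsub>D\<^esub> FArr F f"
    and FArr_Add: "f \<in> Hom C X Y \<Longrightarrow> f' \<in> Hom C X Y \<Longrightarrow>
      FArr F (Add C f f') = Add D (FArr F f) (FArr F f')"

text \<open>Exactness of \<open>X \<rightarrow> Y \<rightarrow> Z \<rightarrow> 0\<close> means that \<open>Y \<rightarrow> Z\<close> is a cokernel of \<open>X \<rightarrow> Y\<close>.\<close>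

locale right_exact_functor = additive_functor +
  assumes preserves_cokernel: "is_cokernel C q f \<Longrightarrow> is_cokernel D (FArr F q) (FArr F f)"


section \<open>Classes of subcategories\<close>

text \<open>A full subcategory is given by its set of objects.\<close>

definition subcategory :: "('o, 'a) precat \<Rightarrow> 'o set \<Rightarrow> bool" where
  "subcategory C E \<longleftrightarrow> E \<subseteq> Obj C \<and> (\<exists>X \<in> E. zero_object C X) \<and>
     (\<forall>f. iso_arrow C f \<and> Dom C f \<in> E \<longrightarrow> Cod C f \<in> E)"

definition extension_closed :: "('o, 'a) precat \<Rightarrow> 'o set \<Rightarrow> bool" where
  "extension_closed C E \<longleftrightarrow>
     (\<forall>f g. short_exact C f g \<and> Dom C f \<in> E \<and> Cod C g \<in> E \<longrightarrow> Cod C f \<in> E)"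

definition kernel_closed :: "('o, 'a) precat \<Rightarrow> 'o set \<Rightarrow> bool" where
  "kernel_closed C E \<longleftrightarrow>
     (\<forall>f k. is_kernel C k f \<and> Dom C f \<in> E \<and> Cod C f \<in> E \<longrightarrow> Dom C k \<in> E)"

definition cokernel_closed :: "('o, 'a) precat \<Rightarrow> 'o set \<Rightarrow> bool" where
  "cokernel_closed C E \<longleftrightarrow>
     (\<forall>f q. is_cokernel C q f \<and> Dom C f \<in> E \<and> Cod C f \<in> E \<longrightarrow> Cod C q \<in> E)"

definition subobject_closed :: "('o, 'a) precat \<Rightarrow> 'o set \<Rightarrow> bool" where
  "subobject_closed C E \<longleftrightarrow> (\<forall>m. monic C m \<and> Cod C m \<in> E \<longrightarrow> Dom C m \<in> E)"

definition simple_in :: "('o, 'a) precat \<Rightarrow> 'o set \<Rightarrow> 'o \<Rightarrow> bool" where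
  "simple_in C E M \<longleftrightarrow> M \<in> E \<and> \<not> zero_object C M \<and>
     \<not> (\<exists>f g. short_exact C f g \<and> Cod C f = M \<and> Dom C f \<in> E \<and> Cod C g \<in> E \<and>
          \<not> zero_object C (Dom C f) \<and> \<not> zero_object C (Cod C g))"

definition left_Schurian :: "('o, 'a) precat \<Rightarrow> 'o set \<Rightarrow> 'o \<Rightarrow> bool" where
  "left_Schurian C E M \<longleftrightarrow> M \<in> Obj C \<and> \<not> zero_object C M \<and>
     (\<forall>X \<in> E. \<forall>f \<in> Hom C M X. f = Zero C M X \<or> monic C f)"

definition left_Schur :: "('o, 'a) precat \<Rightarrow> 'o set \<Rightarrow> bool" where
  "left_Schur C E \<longleftrightarrow> extension_closed C E \<and> (\<forall>M. simple_in C E M \<longrightarrow> left_Schurian C E M)"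

definition wide :: "('o, 'a) precat \<Rightarrow> 'o set \<Rightarrow> bool" where
  "wide C E \<longleftrightarrow> extension_closed C E \<and> kernel_closed C E \<and> cokernel_closed C E"

definition torsion_free :: "('o, 'a) precat \<Rightarrow> 'o set \<Rightarrow> bool" where
  "torsion_free C E \<longleftrightarrow> extension_closed C E \<and> subobject_closed C E"


section \<open>The MacPherson--Vilonen category\<close>

text \<open>For \<open>F : ZZ \<rightarrow> YY\<close>, objects are triples \<open>(Z, Y, f)\<close> with \<open>f : F Z \<rightarrow> Y\<close>. A morphism \<open>(z, y)\<close>
  is stored as \<open>(S, T, z, y)\<close> together with its source \<open>S\<close> and target \<open>T\<close>.\<close>

definition MV_Obj ::
    "('o, 'a) precat \<Rightarrow> ('p, 'b) precat \<Rightarrow> ('p, 'b, 'o, 'a) cfunctor \<Rightarrow> ('p \<times> 'o \<times> 'a) set" where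
  "MV_Obj YY ZZ F = {(Z, Y, f). Z \<in> Obj ZZ \<and> Y \<in> Obj YY \<and> f \<in> Hom YY (FObj F Z) Y}"

definition MV_Hom ::
    "('o, 'a) precat \<Rightarrow> ('p, 'b) precat \<Rightarrow> ('p, 'b, 'o, 'a) cfunctor \<Rightarrow>
     ('p \<times> 'o \<times> 'a) \<Rightarrow> ('p \<times> 'o \<times> 'a) \<Rightarrow> ('b \<times> 'a) set" where
  "MV_Hom YY ZZ F = (\<lambda>(Z, Y, f) (Z', Y', f').
     {(z, y). z \<in> Hom ZZ Z Z' \<and> y \<in> Hom YY Y Y' \<and> y \<cdot>\<^bsub>YY\<^esub> f = f' \<cdot>\<^bsub>YY\<^esub> FArr F z})"

definition MV_category ::
    "('o, 'a) precat \<Rightarrow> ('p, 'b) precat \<Rightarrow> ('p, 'b, 'o, 'a) cfunctor \<Rightarrow>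
     ('p \<times> 'o \<times> 'a, ('p \<times> 'o \<times> 'a) \<times> ('p \<times> 'o \<times> 'a) \<times> 'b \<times> 'a) precat" where
  "MV_category YY ZZ F =
     \<lparr>Obj = MV_Obj YY ZZ F,
      Arr = {(S, T, z, y). S \<in> MV_Obj YY ZZ F \<and> T \<in> MV_Obj YY ZZ F \<and> (z, y) \<in> MV_Hom YY ZZ F S T},
      Dom = (\<lambda>(S, T, z, y). S),
      Cod = (\<lambda>(S, T, z, y). T),
      Id = (\<lambda>(Z, Y, f). ((Z, Y, f), (Z, Y, f), Id ZZ Z, Id YY Y)),
      Comp = (\<lambda>(S', T', z', y') (S, T, z, y). (S, T', z' \<cdot>\<^bsub>ZZ\<^esub> z, y' \<cdot>\<^bsub>YY\<^esub> y)),
      Add = (\<lambda>(S', T', z', y') (S, T, z, y). (S, T, Add ZZ z' z, Add YY y' y)),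
      Zero = (\<lambda>(Z, Y, f) (Z', Y', f').
        ((Z, Y, f), (Z', Y', f'), Zero ZZ Z Z', Zero YY Y Y'))\<rparr>"

definition MV_sub ::
    "('o, 'a) precat \<Rightarrow> ('p, 'b) precat \<Rightarrow> ('p, 'b, 'o, 'a) cfunctor \<Rightarrow>
     'o set \<Rightarrow> 'p set \<Rightarrow> ('p \<times> 'o \<times> 'a) set" where
  "MV_sub YY ZZ F E\<^sub>Y E\<^sub>Z = {(Z, Y, f) \<in> Obj (MV_category YY ZZ F). Z \<in> E\<^sub>Z \<and> Y \<in> E\<^sub>Y}"

end

theory Submission
  imports Defs
begin

text \<open>Kernels, cokernels, monomorphisms and zero objects of the MacPherson--Vilonen category are
  computed componentwise; for cokernels this is where right exactness of \<open>F\<close> enters. Hence every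
  closure property passes to \<open>\<Y>\<close> and \<open>\<Z>\<close> along the exact embeddings \<open>Y \<mapsto> (0, Y, 0)\<close> and
  \<open>Z \<mapsto> (Z, 0, 0)\<close>, and back along the projections. For the left Schur property, the exact sequence
  \<open>0 \<rightarrow> (0, Y, 0) \<rightarrow> (Z, Y, f) \<rightarrow> (Z, 0, 0) \<rightarrow> 0\<close> shows that a simple object of \<open>\<E>\<^sub>X\<close> has \<open>Z = 0\<close> or
  \<open>Y = 0\<close>, so it is a simple object of \<open>\<E>\<^sub>Y\<close> or of \<open>\<E>\<^sub>Z\<close>.\<close>

section \<open>Zero morphisms and zero objects\<close>

text \<open>To read a universal property of the triple category in one component, that component
  needs test objects, and adjoints of the projections provide them. The projection to the
  Z-component has adjoints on both sides and the one to the Y-component has a left adjoint, so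
  kernels and monomorphisms can be tested in both components and cokernels in the Z-component. A
  right adjoint of the projection to the Y-component would yield a right adjoint of
  \<open>F\<close>, which right exactness does not supply. The Y-component of a cokernel is
  therefore treated second: once its Z-component \<open>q\<close> is known to be a cokernel, so is
  \<open>FArr F q\<close>, and each map that has to factor determines a test object of its own.

  Zero objects are not unique, so both embeddings take the zero object as a parameter. With
  \<open>Y\<close> itself as the parameter, a triple \<open>(Z, Y, f)\<close> with zero
  \<open>Y\<close> equals an embedded object, and the case split on simple objects yields equalities
  rather than isomorphisms.\<close>

lemma Hom_Arr: "f \<in> Hom C X Y \<Longrightarrow> f \<in> Arr C"
  and Hom_Dom: "f \<in> Hom C X Y \<Longrightarrow> Dom C f = X"
  and Hom_Cod: "f \<in> Hom C X Y \<Longrightarrow> Cod C f = Y"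
  and Arr_Hom: "f \<in> Arr C \<Longrightarrow> f \<in> Hom C (Dom C f) (Cod C f)"
  by (auto simp: Hom_def)

lemma zero_object_Obj: "zero_object C X \<Longrightarrow> X \<in> Obj C"
  by (simp add: zero_object_def)

text \<open>With the ends of both arrows named, the universal property ranges over explicit
  hom-sets; the later kernel arguments use this form.\<close>

lemma is_kernel_iff:
  assumes "f \<in> Hom C X Y" "k \<in> Hom C K X"
  shows "is_kernel C k f \<longleftrightarrow> f \<cdot>\<^bsub>C\<^esub> k = Zero C K Y \<and>
    (\<forall>W \<in> Obj C. \<forall>h \<in> Hom C W X. f \<cdot>\<^bsub>C\<^esub> h = Zero C W Y \<longrightarrow>
       (\<exists>!u. u \<in> Hom C W K \<and> k \<cdot>\<^bsub>C\<^esub> u = h))"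
  using assms by (simp add: is_kernel_def Hom_def)

lemma is_cokernel_iff:
  assumes "f \<in> Hom C X Y" "q \<in> Hom C Y Q"
  shows "is_cokernel C q f \<longleftrightarrow> q \<cdot>\<^bsub>C\<^esub> f = Zero C X Q \<and>
    (\<forall>W \<in> Obj C. \<forall>h \<in> Hom C Y W. h \<cdot>\<^bsub>C\<^esub> f = Zero C X W \<longrightarrow>
       (\<exists>!u. u \<in> Hom C Q W \<and> u \<cdot>\<^bsub>C\<^esub> q = h))"
  using assms by (simp add: is_cokernel_def Hom_def)

lemma monic_iff:
  assumes "f \<in> Hom C X Y"
  shows "monic C f \<longleftrightarrow> (\<forall>W \<in> Obj C. \<forall>g \<in> Hom C W X. \<forall>h \<in> Hom C W X.
    f \<cdot>\<^bsub>C\<^esub> g = f \<cdot>\<^bsub>C\<^esub> h \<longrightarrow> g = h)"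
  using assms by (simp add: monic_def Hom_def)

context category
begin

lemma Hom_Obj: "f \<in> Hom C X Y \<Longrightarrow> X \<in> Obj C" "f \<in> Hom C X Y \<Longrightarrow> Y \<in> Obj C"
  using Dom_in Cod_in by (auto simp: Hom_def)

end

context preadditive_category
begin

lemma Zero_in [simp]: "X \<in> Obj C \<Longrightarrow> Y \<in> Obj C \<Longrightarrow> Zero C X Y \<in> Hom C X Y"
  using Hom_comm_group[THEN comm_group.axioms(2), THEN group.is_monoid, THEN monoid.one_closed]
  by (simp add: Hom_group_def)

lemma Add_Zero_Zero: "X \<in> Obj C \<Longrightarrow> Y \<in> Obj C \<Longrightarrow> Add C (Zero C X Y) (Zero C X Y) = Zero C X Y"
  using Hom_comm_group[of X Y, THEN comm_group.axioms(2), THEN group.is_monoid,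
      THEN monoid.l_one, of "Zero C X Y"] Zero_in[of X Y]
  by (simp add: Hom_group_def)

text \<open>Cancellation in the group of arrows. Bilinearity of composition, or additivity of a
  functor, makes the image of a zero arrow idempotent under addition, and this criterion then shows
  that it is zero.\<close>

lemma Add_idem_eq_Zero:
  assumes "f \<in> Hom C X Y" "Add C f f = f"
  shows "f = Zero C X Y"
proof -
  interpret G: comm_group "Hom_group C X Y"
    using Hom_comm_group Hom_Obj assms by blast
  show ?thesis
    using assms G.l_cancel_one[of f f] by (simp add: Hom_group_def)
qed

lemma Comp_Zero:
  assumes "g \<in> Hom C Y Z" "X \<in> Obj C"
  shows "g \<cdot>\<^bsub>C\<^esub> Zero C X Y = Zero C X Z"
proof (rule Add_idem_eq_Zero)
  have Z: "Zero C X Y \<in> Hom C X Y"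
    using assms Hom_Obj by simp
  then show "g \<cdot>\<^bsub>C\<^esub> Zero C X Y \<in> Hom C X Z"
    using assms Comp_in by blast
  show "Add C (g \<cdot>\<^bsub>C\<^esub> Zero C X Y) (g \<cdot>\<^bsub>C\<^esub> Zero C X Y) = g \<cdot>\<^bsub>C\<^esub> Zero C X Y"
    using Comp_Add[OF Z Z assms(1)] Add_Zero_Zero assms Hom_Obj by metis
qed

lemma Zero_Comp:
  assumes "f \<in> Hom C X Y" "Z \<in> Obj C"
  shows "Zero C Y Z \<cdot>\<^bsub>C\<^esub> f = Zero C X Z"
proof (rule Add_idem_eq_Zero)
  have Z: "Zero C Y Z \<in> Hom C Y Z"
    using assms Hom_Obj by simp
  then show "Zero C Y Z \<cdot>\<^bsub>C\<^esub> f \<in> Hom C X Z"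
    using assms Comp_in by blast
  show "Add C (Zero C Y Z \<cdot>\<^bsub>C\<^esub> f) (Zero C Y Z \<cdot>\<^bsub>C\<^esub> f) = Zero C Y Z \<cdot>\<^bsub>C\<^esub> f"
    using Add_Comp[OF assms(1) Z Z] Add_Zero_Zero assms Hom_Obj by metis
qed

lemma zero_object_Hom_eqI:
  assumes "zero_object C X \<or> zero_object C Y" "f \<in> Hom C X Y" "g \<in> Hom C X Y"
  shows "f = g"
  using assms Hom_Obj unfolding zero_object_def by metis

text \<open>An equation between two arrows characterises zero objects, so additive functors preserve
  them. For the converse, every arrow from or to \<open>X\<close> equals its composite with the
  identity of \<open>X\<close>, which is zero.\<close>

lemma zero_object_iff_Id: "zero_object C X \<longleftrightarrow> X \<in> Obj C \<and> Id C X = Zero C X X"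
proof
  assume "zero_object C X"
  then show "X \<in> Obj C \<and> Id C X = Zero C X X"
    using zero_object_Hom_eqI[of X X] Id_in Zero_in by (auto simp: zero_object_def)
next
  assume X: "X \<in> Obj C \<and> Id C X = Zero C X X"
  have "f = Zero C X Y" if "f \<in> Hom C X Y" for f Y
    using Comp_Id[OF that] Comp_Zero[OF that, of X] X by simp
  moreover have "f = Zero C Y X" if "f \<in> Hom C Y X" for f Y
    using Id_Comp[OF that] Zero_Comp[OF that, of X] X by simp
  ultimately show "zero_object C X"
    unfolding zero_object_def using X Zero_in by metis
qed

text \<open>Two arrows with the same composite with \<open>k\<close> are both factorizations of that
  composite, which \<open>f\<close> kills; factorizations through a kernel are unique.\<close>

lemma is_kernel_monic:
  assumes "is_kernel C k f"
  shows "monic C k"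
proof -
  define X Y K where "X = Dom C f" and "Y = Cod C f" and "K = Dom C k"
  have f: "f \<in> Hom C X Y" and k: "k \<in> Hom C K X"
    using assms by (auto simp: is_kernel_def Hom_def X_def Y_def K_def)
  have "g = h" if "W \<in> Obj C" "g \<in> Hom C W K" "h \<in> Hom C W K" "k \<cdot>\<^bsub>C\<^esub> g = k \<cdot>\<^bsub>C\<^esub> h" for W g h
  proof -
    have "f \<cdot>\<^bsub>C\<^esub> (k \<cdot>\<^bsub>C\<^esub> g) = Zero C W Y"
      using Comp_assoc[OF that(2) k f] assms is_kernel_iff[OF f k] Zero_Comp that Hom_Obj f by metis
    then show ?thesis
      using assms that Comp_in[OF that(2) k] unfolding is_kernel_iff[OF f k] by metis
  qed
  then show ?thesis
    unfolding monic_iff[OF k] by blast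
qed

lemma is_cokernel_epic:
  assumes "is_cokernel C q f"
  shows "epic C q"
proof -
  define X Y Q where "X = Dom C f" and "Y = Cod C f" and "Q = Cod C q"
  have f: "f \<in> Hom C X Y" and q: "q \<in> Hom C Y Q"
    using assms by (auto simp: is_cokernel_def Hom_def X_def Y_def Q_def)
  have "g = h" if "W \<in> Obj C" "g \<in> Hom C Q W" "h \<in> Hom C Q W" "g \<cdot>\<^bsub>C\<^esub> q = h \<cdot>\<^bsub>C\<^esub> q" for W g h
  proof -
    have "(g \<cdot>\<^bsub>C\<^esub> q) \<cdot>\<^bsub>C\<^esub> f = Zero C X W"
      using Comp_assoc[OF f q that(2)] assms is_cokernel_iff[OF f q] Comp_Zero that Hom_Obj f by metis
    then show ?thesis
      using assms that Comp_in[OF q that(2)] unfolding is_cokernel_iff[OF f q] by metis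
  qed
  then show ?thesis
    using q unfolding epic_def Q_def by (auto simp: Hom_def)
qed

text \<open>Composed with \<open>f\<close>, the identity and the zero arrow of \<open>X\<close> have
  a zero object as target and agree there; cancelling \<open>f\<close> gives
  \<open>Id C X = Zero C X X\<close>.\<close>

lemma zero_object_if_monic:
  assumes "monic C f" "f \<in> Hom C X Y" "zero_object C Y"
  shows "zero_object C X"
proof -
  have X: "X \<in> Obj C" and i: "Id C X \<in> Hom C X X"
    using Hom_Obj[OF assms(2)] Id_in by auto
  have z: "Zero C X X \<in> Hom C X X"
    using X by simp
  have "f \<cdot>\<^bsub>C\<^esub> Id C X = f \<cdot>\<^bsub>C\<^esub> Zero C X X"
    using zero_object_Hom_eqI assms(3) Comp_in[OF i assms(2)] Comp_in[OF z assms(2)] by blast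
  then have "Id C X = Zero C X X"
    using assms(1) X i z unfolding monic_iff[OF assms(2)] by blast
  with X show ?thesis
    by (simp add: zero_object_iff_Id)
qed

lemma zero_object_if_epic:
  assumes "epic C f" "f \<in> Hom C X Y" "zero_object C X"
  shows "zero_object C Y"
proof -
  have Y: "Y \<in> Obj C" and i: "Id C Y \<in> Hom C Y Y"
    using Hom_Obj[OF assms(2)] Id_in by auto
  have z: "Zero C Y Y \<in> Hom C Y Y"
    using Y by simp
  have "Id C Y \<cdot>\<^bsub>C\<^esub> f = Zero C Y Y \<cdot>\<^bsub>C\<^esub> f"
    using zero_object_Hom_eqI assms(3) Comp_in[OF assms(2) i] Comp_in[OF assms(2) z] by blast
  then have "Id C Y = Zero C Y Y"
    using assms(1) Y i z unfolding epic_def Hom_Cod[OF assms(2)] by blast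
  with Y show ?thesis
    by (simp add: zero_object_iff_Id)
qed

lemma monic_if_zero_object: "zero_object C X \<Longrightarrow> f \<in> Hom C X Y \<Longrightarrow> monic C f"
  using zero_object_Hom_eqI[of _ X] by (auto simp: monic_iff)

text \<open>This degenerate sequence is the Y-component of the sequence in
  \<open>short_exact_MV_split\<close>; the one in \<open>short_exact_Zero_Id\<close> is its
  Z-component.\<close>

lemma short_exact_Id_Zero:
  assumes "X \<in> Obj C" "zero_object C N"
  shows "short_exact C (Id C X) (Zero C X N)"
proof -
  have N: "N \<in> Obj C"
    using assms by (simp add: zero_object_def)
  have i: "Id C X \<in> Hom C X X" and z: "Zero C X N \<in> Hom C X N"
    using assms N Id_in by auto
  have "\<exists>!u. u \<in> Hom C W X \<and> Id C X \<cdot>\<^bsub>C\<^esub> u = h" if "h \<in> Hom C W X" for W h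
    using that Id_Comp by metis
  moreover have "\<exists>!u. u \<in> Hom C N W \<and> u \<cdot>\<^bsub>C\<^esub> Zero C X N = h"
    if h: "h \<in> Hom C X W" and "h \<cdot>\<^bsub>C\<^esub> Id C X = Zero C X W" for W h
  proof -
    have "h = Zero C X W" "W \<in> Obj C"
      using that Comp_Id Hom_Obj by metis+
    then show ?thesis
      using zero_object_Hom_eqI[of N W] assms(2) Zero_in[OF N, of W] Zero_Comp[OF z] by metis
  qed
  ultimately show ?thesis
    unfolding short_exact_def is_kernel_iff[OF z i] is_cokernel_iff[OF i z]
    using Comp_Id[OF z] by blast
qed

lemma short_exact_Zero_Id:
  assumes "X \<in> Obj C" "zero_object C N"
  shows "short_exact C (Zero C N X) (Id C X)"
proof -
  have N: "N \<in> Obj C"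
    using assms by (simp add: zero_object_def)
  have i: "Id C X \<in> Hom C X X" and z: "Zero C N X \<in> Hom C N X"
    using assms N Id_in by auto
  have "\<exists>!u. u \<in> Hom C X W \<and> u \<cdot>\<^bsub>C\<^esub> Id C X = h" if "h \<in> Hom C X W" for W h
    using that Comp_Id by metis
  moreover have "\<exists>!u. u \<in> Hom C W N \<and> Zero C N X \<cdot>\<^bsub>C\<^esub> u = h"
    if h: "h \<in> Hom C W X" and "Id C X \<cdot>\<^bsub>C\<^esub> h = Zero C W X" for W h
  proof -
    have "h = Zero C W X" "W \<in> Obj C"
      using that Id_Comp Hom_Obj by metis+
    then show ?thesis
      using zero_object_Hom_eqI[of W N] assms(2) Zero_in[OF _ N, of W] Zero_Comp[OF _ assms(1)] 
      by metis
  qed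
  ultimately show ?thesis
    unfolding short_exact_def is_kernel_iff[OF i z] is_cokernel_iff[OF z i]
    using Id_Comp[OF z] by blast
qed

end

context additive_functor
begin

lemma FArr_Zero:
  assumes "X \<in> Obj C" "Y \<in> Obj C"
  shows "FArr F (Zero C X Y) = Zero D (FObj F X) (FObj F Y)"
proof (rule D.Add_idem_eq_Zero)
  have Z: "Zero C X Y \<in> Hom C X Y"
    using assms by simp
  then show "FArr F (Zero C X Y) \<in> Hom D (FObj F X) (FObj F Y)"
    by (rule FArr_in)
  show "Add D (FArr F (Zero C X Y)) (FArr F (Zero C X Y)) = FArr F (Zero C X Y)"
    using FArr_Add[OF Z Z] C.Add_Zero_Zero assms by metis
qed

lemma zero_object_FObj:
  assumes "zero_object C X"
  shows "zero_object D (FObj F X)"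
  using assms FArr_Zero[of X X] FArr_Id[of X] FObj_in
  unfolding C.zero_object_iff_Id D.zero_object_iff_Id by metis

end


section \<open>Componentwise structure of the MacPherson--Vilonen category\<close>

locale macpherson_vilonen = Z: abelian_category ZZ + Y: abelian_category YY +
    right_exact_functor ZZ YY F
  for ZZ :: "('p, 'b) precat" and YY :: "('o, 'a) precat" and F :: "('p, 'b, 'o, 'a) cfunctor"
begin

abbreviation "MV \<equiv> MV_category YY ZZ F"

lemma MV_Obj_iff: "(Z, Y, f) \<in> Obj MV \<longleftrightarrow> Z \<in> Obj ZZ \<and> Y \<in> Obj YY \<and> f \<in> Hom YY (FObj F Z) Y"
  by (simp add: MV_category_def MV_Obj_def)

lemma MV_Comp [simp]:
  "(S', T', z', y') \<cdot>\<^bsub>MV\<^esub> (S, T, z, y) = (S, T', z' \<cdot>\<^bsub>ZZ\<^esub> z, y' \<cdot>\<^bsub>YY\<^esub> y)"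
  by (simp add: MV_category_def)

lemma MV_Zero [simp]:
  "Zero MV (Z, Y, f) (Z', Y', f') = ((Z, Y, f), (Z', Y', f'), Zero ZZ Z Z', Zero YY Y Y')"
  by (simp add: MV_category_def)

lemma MV_Dom [simp]: "Dom MV (S, T, z, y) = S"
  and MV_Cod [simp]: "Cod MV (S, T, z, y) = T"
  by (simp_all add: MV_category_def)

text \<open>Arrows have their ends in \<open>Obj\<close>, so the hom-set conditions already contain
  those on \<open>Z\<close>, \<open>Z'\<close>, \<open>Y\<close> and \<open>Y'\<close>; what remains
  is typing and the commuting square.\<close>

lemma MV_Arr_iff: "((Z, Y, f), (Z', Y', f'), z, y) \<in> Arr MV \<longleftrightarrow>
    f \<in> Hom YY (FObj F Z) Y \<and> f' \<in> Hom YY (FObj F Z') Y' \<and> z \<in> Hom ZZ Z Z' \<and> y \<in> Hom YY Y Y' \<and>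
    y \<cdot>\<^bsub>YY\<^esub> f = f' \<cdot>\<^bsub>YY\<^esub> FArr F z"
  by (auto simp: MV_category_def MV_Obj_def MV_Hom_def dest: Z.Hom_Obj Y.Hom_Obj)

lemma MV_Hom_iff: "m \<in> Hom MV S T \<longleftrightarrow> (\<exists>z y. m = (S, T, z, y) \<and> (S, T, z, y) \<in> Arr MV)"
  by (cases m) (auto simp: Hom_def)

lemma MV_Arr_cases:
  assumes "m \<in> Arr MV"
  obtains Z Y f Z' Y' f' z y where "m = ((Z, Y, f), (Z', Y', f'), z, y)"
  using assms by (metis prod_cases3)

section \<open>Kernels and cokernels assembled from components\<close>

lemma MV_is_kernelI:
  assumes "((A\<^sub>Z, A\<^sub>Y, a), (B\<^sub>Z, B\<^sub>Y, b), z, y) \<in> Arr MV" "((K\<^sub>Z, K\<^sub>Y, c), (A\<^sub>Z, A\<^sub>Y, a), k, l) \<in> Arr MV"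
    and "is_kernel ZZ k z" "is_kernel YY l y"
  shows "is_kernel MV ((K\<^sub>Z, K\<^sub>Y, c), (A\<^sub>Z, A\<^sub>Y, a), k, l) ((A\<^sub>Z, A\<^sub>Y, a), (B\<^sub>Z, B\<^sub>Y, b), z, y)"
proof -
  let ?A = "(A\<^sub>Z, A\<^sub>Y, a)" and ?B = "(B\<^sub>Z, B\<^sub>Y, b)" and ?K = "(K\<^sub>Z, K\<^sub>Y, c)"
  have a: "a \<in> Hom YY (FObj F A\<^sub>Z) A\<^sub>Y" and c: "c \<in> Hom YY (FObj F K\<^sub>Z) K\<^sub>Y"
    and z: "z \<in> Hom ZZ A\<^sub>Z B\<^sub>Z" and y: "y \<in> Hom YY A\<^sub>Y B\<^sub>Y"
    and k: "k \<in> Hom ZZ K\<^sub>Z A\<^sub>Z" and l: "l \<in> Hom YY K\<^sub>Y A\<^sub>Y"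
    and lc: "l \<cdot>\<^bsub>YY\<^esub> c = a \<cdot>\<^bsub>YY\<^esub> FArr F k"
    using assms(1,2) by (auto simp: MV_Arr_iff)
  have m': "(?A, ?B, z, y) \<in> Hom MV ?A ?B" and k': "(?K, ?A, k, l) \<in> Hom MV ?K ?A"
    using assms(1,2) by (auto simp: MV_Hom_iff)
  note kz = assms(3)[unfolded is_kernel_iff[OF z k]] and ly = assms(4)[unfolded is_kernel_iff[OF y l]]
  have "\<exists>!u. u \<in> Hom MV W ?K \<and> (?K, ?A, k, l) \<cdot>\<^bsub>MV\<^esub> u = h"
    if h: "h \<in> Hom MV W ?A" "(?A, ?B, z, y) \<cdot>\<^bsub>MV\<^esub> h = Zero MV W ?B" for W h
  proof -
    obtain W\<^sub>Z W\<^sub>Y w where W: "W = (W\<^sub>Z, W\<^sub>Y, w)" by (metis prod_cases3)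
    obtain h\<^sub>Z h\<^sub>Y where h_eq: "h = (W, ?A, h\<^sub>Z, h\<^sub>Y)" and "(W, ?A, h\<^sub>Z, h\<^sub>Y) \<in> Arr MV"
      using h(1) by (auto simp: MV_Hom_iff)
    then have hZ: "h\<^sub>Z \<in> Hom ZZ W\<^sub>Z A\<^sub>Z" and hY: "h\<^sub>Y \<in> Hom YY W\<^sub>Y A\<^sub>Y"
      and w: "w \<in> Hom YY (FObj F W\<^sub>Z) W\<^sub>Y" and hw: "h\<^sub>Y \<cdot>\<^bsub>YY\<^esub> w = a \<cdot>\<^bsub>YY\<^esub> FArr F h\<^sub>Z"
      by (auto simp: W MV_Arr_iff)
    have zh: "z \<cdot>\<^bsub>ZZ\<^esub> h\<^sub>Z = Zero ZZ W\<^sub>Z B\<^sub>Z" and yh: "y \<cdot>\<^bsub>YY\<^esub> h\<^sub>Y = Zero YY W\<^sub>Y B\<^sub>Y"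
      using h(2) by (simp_all add: W h_eq)
    obtain u where u: "u \<in> Hom ZZ W\<^sub>Z K\<^sub>Z" "k \<cdot>\<^bsub>ZZ\<^esub> u = h\<^sub>Z"
      using kz zh hZ Z.Hom_Obj[OF hZ] by blast
    obtain v where v: "v \<in> Hom YY W\<^sub>Y K\<^sub>Y" "l \<cdot>\<^bsub>YY\<^esub> v = h\<^sub>Y"
      using ly yh hY Y.Hom_Obj[OF hY] by blast
    \<comment> \<open>The factorizations \<open>u\<close> and \<open>v\<close> are found separately.
      That they respect the structure maps \<open>w\<close> and \<open>c\<close> is checked after
      composing with \<open>l\<close>, a kernel and hence monic; both sides become \<open>a\<close>
      after \<open>FArr F h\<^sub>Z\<close>.\<close>
    have "l \<cdot>\<^bsub>YY\<^esub> (v \<cdot>\<^bsub>YY\<^esub> w) = l \<cdot>\<^bsub>YY\<^esub> (c \<cdot>\<^bsub>YY\<^esub> FArr F u)"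
      using Y.Comp_assoc[OF w v(1) l] Y.Comp_assoc[OF FArr_in[OF u(1)] c l]
        Y.Comp_assoc[OF FArr_in[OF u(1)] FArr_in[OF k] a] FArr_Comp[OF u(1) k] u v hw lc
      by simp
    then have "v \<cdot>\<^bsub>YY\<^esub> w = c \<cdot>\<^bsub>YY\<^esub> FArr F u"
      using Y.is_kernel_monic[OF assms(4)] Y.Comp_in[OF w v(1)] Y.Comp_in[OF FArr_in[OF u(1)] c]
        Y.Hom_Obj[OF w]
      unfolding monic_iff[OF l] by blast
    then have "(W, ?K, u, v) \<in> Hom MV W ?K"
      using u v w c by (simp add: W MV_Hom_iff MV_Arr_iff)
    moreover have "u' = (W, ?K, u, v)" if u'_Hom: "u' \<in> Hom MV W ?K" and u'_Comp: "(?K, ?A, k, l) \<cdot>\<^bsub>MV\<^esub> u' = h" for u'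
    proof -
      obtain u\<^sub>Z u\<^sub>Y where u': "u' = (W, ?K, u\<^sub>Z, u\<^sub>Y)" and "u\<^sub>Z \<in> Hom ZZ W\<^sub>Z K\<^sub>Z" "u\<^sub>Y \<in> Hom YY W\<^sub>Y K\<^sub>Y"
        using u'_Hom by (auto simp: W MV_Hom_iff MV_Arr_iff)
      moreover have "k \<cdot>\<^bsub>ZZ\<^esub> u\<^sub>Z = h\<^sub>Z" "l \<cdot>\<^bsub>YY\<^esub> u\<^sub>Y = h\<^sub>Y"
        using u'_Comp by (auto simp: u' h_eq)
      ultimately show ?thesis
        using u v Z.is_kernel_monic[OF assms(3)] Y.is_kernel_monic[OF assms(4)]
          Z.Hom_Obj[OF hZ] Y.Hom_Obj[OF hY]
        unfolding monic_iff[OF l] monic_iff[OF k] by blast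
    qed
    moreover have "(?K, ?A, k, l) \<cdot>\<^bsub>MV\<^esub> (W, ?K, u, v) = h"
      using u v by (simp add: h_eq)
    ultimately show ?thesis by blast
  qed
  then show ?thesis
    unfolding is_kernel_iff[OF m' k'] using kz ly by simp
qed

lemma MV_is_cokernelI:
  assumes "((A\<^sub>Z, A\<^sub>Y, a), (B\<^sub>Z, B\<^sub>Y, b), z, y) \<in> Arr MV" "((B\<^sub>Z, B\<^sub>Y, b), (Q\<^sub>Z, Q\<^sub>Y, c), q, r) \<in> Arr MV"
    and "is_cokernel ZZ q z" "is_cokernel YY r y"
  shows "is_cokernel MV ((B\<^sub>Z, B\<^sub>Y, b), (Q\<^sub>Z, Q\<^sub>Y, c), q, r) ((A\<^sub>Z, A\<^sub>Y, a), (B\<^sub>Z, B\<^sub>Y, b), z, y)"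
proof -
  let ?A = "(A\<^sub>Z, A\<^sub>Y, a)" and ?B = "(B\<^sub>Z, B\<^sub>Y, b)" and ?Q = "(Q\<^sub>Z, Q\<^sub>Y, c)"
  have b: "b \<in> Hom YY (FObj F B\<^sub>Z) B\<^sub>Y" and c: "c \<in> Hom YY (FObj F Q\<^sub>Z) Q\<^sub>Y"
    and z: "z \<in> Hom ZZ A\<^sub>Z B\<^sub>Z" and y: "y \<in> Hom YY A\<^sub>Y B\<^sub>Y"
    and q: "q \<in> Hom ZZ B\<^sub>Z Q\<^sub>Z" and r: "r \<in> Hom YY B\<^sub>Y Q\<^sub>Y"
    and rb: "r \<cdot>\<^bsub>YY\<^esub> b = c \<cdot>\<^bsub>YY\<^esub> FArr F q"
    using assms(1,2) by (auto simp: MV_Arr_iff)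
  have m': "(?A, ?B, z, y) \<in> Hom MV ?A ?B" and q': "(?B, ?Q, q, r) \<in> Hom MV ?B ?Q"
    using assms(1,2) by (auto simp: MV_Hom_iff)
  note qz = assms(3)[unfolded is_cokernel_iff[OF z q]]
    and ry = assms(4)[unfolded is_cokernel_iff[OF y r]]
  have "\<exists>!u. u \<in> Hom MV ?Q W \<and> u \<cdot>\<^bsub>MV\<^esub> (?B, ?Q, q, r) = h"
    if h: "h \<in> Hom MV ?B W" "h \<cdot>\<^bsub>MV\<^esub> (?A, ?B, z, y) = Zero MV ?A W" for W h
  proof -
    obtain W\<^sub>Z W\<^sub>Y w where W: "W = (W\<^sub>Z, W\<^sub>Y, w)" by (metis prod_cases3)
    obtain h\<^sub>Z h\<^sub>Y where h_eq: "h = (?B, W, h\<^sub>Z, h\<^sub>Y)" and "(?B, W, h\<^sub>Z, h\<^sub>Y) \<in> Arr MV"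
      using h(1) by (auto simp: MV_Hom_iff)
    then have hZ: "h\<^sub>Z \<in> Hom ZZ B\<^sub>Z W\<^sub>Z" and hY: "h\<^sub>Y \<in> Hom YY B\<^sub>Y W\<^sub>Y"
      and w: "w \<in> Hom YY (FObj F W\<^sub>Z) W\<^sub>Y" and hw: "h\<^sub>Y \<cdot>\<^bsub>YY\<^esub> b = w \<cdot>\<^bsub>YY\<^esub> FArr F h\<^sub>Z"
      by (auto simp: W MV_Arr_iff)
    have hz: "h\<^sub>Z \<cdot>\<^bsub>ZZ\<^esub> z = Zero ZZ A\<^sub>Z W\<^sub>Z" and hy: "h\<^sub>Y \<cdot>\<^bsub>YY\<^esub> y = Zero YY A\<^sub>Y W\<^sub>Y"
      using h(2) by (simp_all add: W h_eq)
    obtain u where u: "u \<in> Hom ZZ Q\<^sub>Z W\<^sub>Z" "u \<cdot>\<^bsub>ZZ\<^esub> q = h\<^sub>Z"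
      using qz hz hZ Z.Hom_Obj[OF hZ] by blast
    obtain v where v: "v \<in> Hom YY Q\<^sub>Y W\<^sub>Y" "v \<cdot>\<^bsub>YY\<^esub> r = h\<^sub>Y"
      using ry hy hY Y.Hom_Obj[OF hY] by blast
    \<comment> \<open>The dual check precomposes with \<open>FArr F q\<close>. Right exactness makes
      this arrow a cokernel, hence epic; both sides become \<open>h\<^sub>Y\<close> after
      \<open>b\<close>.\<close>
    have "(v \<cdot>\<^bsub>YY\<^esub> c) \<cdot>\<^bsub>YY\<^esub> FArr F q = (w \<cdot>\<^bsub>YY\<^esub> FArr F u) \<cdot>\<^bsub>YY\<^esub> FArr F q"
      using Y.Comp_assoc[OF FArr_in[OF q] c v(1)] Y.Comp_assoc[OF b r v(1)]
        Y.Comp_assoc[OF FArr_in[OF q] FArr_in[OF u(1)] w] FArr_Comp[OF q u(1)] u v hw rb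
      by simp
    then have "v \<cdot>\<^bsub>YY\<^esub> c = w \<cdot>\<^bsub>YY\<^esub> FArr F u"
      using Y.is_cokernel_epic[OF preserves_cokernel[OF assms(3)]]
        Y.Comp_in[OF c v(1)] Y.Comp_in[OF FArr_in[OF u(1)] w] Y.Hom_Obj[OF w] FArr_in[OF q]
      unfolding epic_def by (auto simp: Hom_Cod)
    then have "(?Q, W, u, v) \<in> Hom MV ?Q W"
      using u v w c by (simp add: W MV_Hom_iff MV_Arr_iff)
    moreover have "u' = (?Q, W, u, v)" if u'_Hom: "u' \<in> Hom MV ?Q W" and u'_Comp: "u' \<cdot>\<^bsub>MV\<^esub> (?B, ?Q, q, r) = h" for u'
    proof -
      obtain u\<^sub>Z u\<^sub>Y where u': "u' = (?Q, W, u\<^sub>Z, u\<^sub>Y)" and "u\<^sub>Z \<in> Hom ZZ Q\<^sub>Z W\<^sub>Z" "u\<^sub>Y \<in> Hom YY Q\<^sub>Y W\<^sub>Y"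
        using u'_Hom by (auto simp: W MV_Hom_iff MV_Arr_iff)
      moreover have "u\<^sub>Z \<cdot>\<^bsub>ZZ\<^esub> q = h\<^sub>Z" "u\<^sub>Y \<cdot>\<^bsub>YY\<^esub> r = h\<^sub>Y"
        using u'_Comp by (auto simp: u' h_eq)
      ultimately show ?thesis
        using u v Z.is_cokernel_epic[OF assms(3)] Y.is_cokernel_epic[OF assms(4)]
          Z.Hom_Obj[OF hZ] Y.Hom_Obj[OF hY] q r
        unfolding epic_def by (auto simp: Hom_Cod)
    qed
    moreover have "(?Q, W, u, v) \<cdot>\<^bsub>MV\<^esub> (?B, ?Q, q, r) = h"
      using u v by (simp add: h_eq)
    ultimately show ?thesis by blast
  qed
  then show ?thesis
    unfolding is_cokernel_iff[OF m' q'] using qz ry by simp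
qed

text \<open>\<open>W \<mapsto> (W, F W, id)\<close> and \<open>W \<mapsto> (0, W, 0)\<close> are left adjoint to the projections to \<open>\<Z>\<close> and to
  \<open>\<Y>\<close>, so these objects test kernels and monomorphisms one component at a time.\<close>

lemma MV_Hom_free:
  assumes "W \<in> Obj ZZ" "f \<in> Hom YY (FObj F Z) Y"
  defines "S \<equiv> (W, FObj F W, Id YY (FObj F W))"
  shows "m \<in> Hom MV S (Z, Y, f) \<longleftrightarrow> (\<exists>u \<in> Hom ZZ W Z. m = (S, (Z, Y, f), u, f \<cdot>\<^bsub>YY\<^esub> FArr F u))"
proof -
  have i: "Id YY (FObj F W) \<in> Hom YY (FObj F W) (FObj F W)"
    using FObj_in[OF assms(1)] Y.Id_in by blast
  \<comment> \<open>With an identity as structure map of \<open>S\<close>, the commuting square is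
    the equation for \<open>v\<close>, so \<open>v\<close> is determined by
    \<open>u\<close>.\<close>
  have "(S, (Z, Y, f), u, v) \<in> Arr MV \<longleftrightarrow> u \<in> Hom ZZ W Z \<and> v = f \<cdot>\<^bsub>YY\<^esub> FArr F u" for u v
    using i Y.Comp_in[OF FArr_in assms(2), of u] Y.Comp_Id[OF Y.Comp_in[OF FArr_in assms(2)], of u]
      Y.Comp_Id[of v] assms(2)
    by (auto simp: S_def MV_Arr_iff)
  then show ?thesis
    by (auto simp: MV_Hom_iff)
qed

lemma MV_Hom_from_Y:
  assumes "zero_object ZZ N" "W \<in> Obj YY" "f \<in> Hom YY (FObj F Z) Y" "Z \<in> Obj ZZ"
  defines "S \<equiv> (N, W, Zero YY (FObj F N) W)"
  shows "m \<in> Hom MV S (Z, Y, f) \<longleftrightarrow> (\<exists>v \<in> Hom YY W Y. m = (S, (Z, Y, f), Zero ZZ N Z, v))"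
proof -
  have N: "N \<in> Obj ZZ"
    using assms by (simp add: zero_object_def)
  have w: "Zero YY (FObj F N) W \<in> Hom YY (FObj F N) W"
    using FObj_in[OF N] assms(2) by simp
  \<comment> \<open>Both sides start at \<open>FObj F N\<close>, a zero object, so the square
    commutes for every \<open>v\<close>.\<close>
  have "v \<cdot>\<^bsub>YY\<^esub> Zero YY (FObj F N) W = f \<cdot>\<^bsub>YY\<^esub> FArr F u" if "v \<in> Hom YY W Y" "u \<in> Hom ZZ N Z" for u v
    using Y.zero_object_Hom_eqI[OF disjI1[OF zero_object_FObj[OF assms(1)]]]
      Y.Comp_in[OF w that(1)] Y.Comp_in[OF FArr_in[OF that(2)] assms(3)] by blast
  then show ?thesis
    using Z.zero_object_Hom_eqI[OF disjI1[OF assms(1)], of _ Z] Z.Zero_in[OF N assms(4)] w assms(3)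
    unfolding S_def MV_Hom_iff MV_Arr_iff by blast
qed

text \<open>These objects give the right adjoint of the projection to the Z-component: the square
  ends at a zero object and commutes automatically. They test cokernels in that component.\<close>

lemma MV_Hom_to_Z:
  assumes "zero_object YY N" "W \<in> Obj ZZ" "f \<in> Hom YY (FObj F Z) Y"
  defines "T \<equiv> (W, N, Zero YY (FObj F W) N)"
  shows "m \<in> Hom MV (Z, Y, f) T \<longleftrightarrow> (\<exists>u \<in> Hom ZZ Z W. m = ((Z, Y, f), T, u, Zero YY Y N))"
proof -
  have N: "N \<in> Obj YY"
    using assms by (simp add: zero_object_def)
  have w: "Zero YY (FObj F W) N \<in> Hom YY (FObj F W) N"
    using FObj_in[OF assms(2)] N by simp
  have "v \<cdot>\<^bsub>YY\<^esub> f = Zero YY (FObj F W) N \<cdot>\<^bsub>YY\<^esub> FArr F u" if "v \<in> Hom YY Y N" "u \<in> Hom ZZ Z W" for u v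
    using Y.zero_object_Hom_eqI[OF disjI2[OF assms(1)]]
      Y.Comp_in[OF assms(3) that(1)] Y.Comp_in[OF FArr_in[OF that(2)] w] by blast
  then show ?thesis
    using Y.zero_object_Hom_eqI[OF disjI2[OF assms(1)], of _ Y] Y.Zero_in[OF Y.Hom_Obj(2)[OF assms(3)] N]
      w assms(3)
    unfolding T_def MV_Hom_iff MV_Arr_iff by blast
qed

section \<open>Components of kernels and cokernels\<close>

text \<open>A test arrow \<open>h\<close> into one component is replaced by its transpose under the
  adjunction for that component; the unique factorization in \<open>MV\<close> is then read back in
  the component.\<close>

lemma MV_is_kernelD:
  assumes "is_kernel MV ((K\<^sub>Z, K\<^sub>Y, c), (A\<^sub>Z, A\<^sub>Y, a), k, l) ((A\<^sub>Z, A\<^sub>Y, a), (B\<^sub>Z, B\<^sub>Y, b), z, y)"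
  shows "is_kernel ZZ k z" "is_kernel YY l y"
proof -
  let ?A = "(A\<^sub>Z, A\<^sub>Y, a)" and ?B = "(B\<^sub>Z, B\<^sub>Y, b)" and ?K = "(K\<^sub>Z, K\<^sub>Y, c)"
  have m': "(?A, ?B, z, y) \<in> Hom MV ?A ?B" and k': "(?K, ?A, k, l) \<in> Hom MV ?K ?A"
    using assms by (auto simp: is_kernel_def MV_Hom_iff)
  have a: "a \<in> Hom YY (FObj F A\<^sub>Z) A\<^sub>Y" and c: "c \<in> Hom YY (FObj F K\<^sub>Z) K\<^sub>Y"
    and b: "b \<in> Hom YY (FObj F B\<^sub>Z) B\<^sub>Y"
    and z: "z \<in> Hom ZZ A\<^sub>Z B\<^sub>Z" and y: "y \<in> Hom YY A\<^sub>Y B\<^sub>Y"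
    and k: "k \<in> Hom ZZ K\<^sub>Z A\<^sub>Z" and l: "l \<in> Hom YY K\<^sub>Y A\<^sub>Y"
    and lc: "l \<cdot>\<^bsub>YY\<^esub> c = a \<cdot>\<^bsub>YY\<^esub> FArr F k" and ya: "y \<cdot>\<^bsub>YY\<^esub> a = b \<cdot>\<^bsub>YY\<^esub> FArr F z"
    using m' k' by (auto simp: MV_Arr_iff MV_Hom_iff)
  note ker = assms[unfolded is_kernel_iff[OF m' k']]
  have "\<exists>!u. u \<in> Hom ZZ W K\<^sub>Z \<and> k \<cdot>\<^bsub>ZZ\<^esub> u = h"
    if h: "h \<in> Hom ZZ W A\<^sub>Z" "z \<cdot>\<^bsub>ZZ\<^esub> h = Zero ZZ W B\<^sub>Z" for W h
  proof -
    have W: "W \<in> Obj ZZ" using Z.Hom_Obj[OF h(1)] by simp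
    let ?W = "(W, FObj F W, Id YY (FObj F W))"
    let ?h = "(?W, ?A, h, a \<cdot>\<^bsub>YY\<^esub> FArr F h)"
    note FW = FObj_in[OF W]
    \<comment> \<open>The Y-component of the transpose is killed as well: the square for
      \<open>(z, y)\<close> turns the composite into \<open>b\<close> after \<open>F\<close> of the
      composite of \<open>z\<close> and \<open>h\<close>, which is zero.\<close>
    have "y \<cdot>\<^bsub>YY\<^esub> (a \<cdot>\<^bsub>YY\<^esub> FArr F h) = Zero YY (FObj F W) B\<^sub>Y"
      using Y.Comp_assoc[OF FArr_in[OF h(1)] a y] Y.Comp_assoc[OF FArr_in[OF h(1)] FArr_in[OF z] b]
        FArr_Comp[OF h(1) z] FArr_Zero[OF W] h(2) ya Y.Comp_Zero[OF b FW] Z.Hom_Obj[OF z] by simp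
    moreover have "?h \<in> Hom MV ?W ?A"
      using MV_Hom_free[OF W a] h(1) by blast
    ultimately have ex1: "\<exists>!u. u \<in> Hom MV ?W ?K \<and> (?K, ?A, k, l) \<cdot>\<^bsub>MV\<^esub> u = ?h"
      using ker h(2) W FW Y.Id_in[OF FW] MV_Obj_iff by simp
    \<comment> \<open>Every factorization of \<open>h\<close> transposes to a factorization of
      \<open>?h\<close>, so uniqueness in \<open>MV\<close> gives uniqueness in the
      component.\<close>
    have lift: "(?W, ?K, u, c \<cdot>\<^bsub>YY\<^esub> FArr F u) \<in> Hom MV ?W ?K"
      "(?K, ?A, k, l) \<cdot>\<^bsub>MV\<^esub> (?W, ?K, u, c \<cdot>\<^bsub>YY\<^esub> FArr F u) = ?h"
      if "u \<in> Hom ZZ W K\<^sub>Z" "k \<cdot>\<^bsub>ZZ\<^esub> u = h" for u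
      using MV_Hom_free[OF W c] Y.Comp_assoc[OF FArr_in[OF that(1)] c l] lc
        Y.Comp_assoc[OF FArr_in[OF that(1)] FArr_in[OF k] a] FArr_Comp[OF that(1) k] that by auto
    have "\<exists>u. u \<in> Hom ZZ W K\<^sub>Z \<and> k \<cdot>\<^bsub>ZZ\<^esub> u = h"
      using ex1_implies_ex[OF ex1] by (auto simp: MV_Hom_iff MV_Arr_iff)
    moreover have "u = u'"
      if "u \<in> Hom ZZ W K\<^sub>Z" "k \<cdot>\<^bsub>ZZ\<^esub> u = h" "u' \<in> Hom ZZ W K\<^sub>Z" "k \<cdot>\<^bsub>ZZ\<^esub> u' = h" for u u'
      using ex1 lift[OF that(1,2)] lift[OF that(3,4)] by (metis Pair_inject)
    ultimately show ?thesis by blast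
  qed
  then show "is_kernel ZZ k z"
    unfolding is_kernel_iff[OF z k] using ker by simp
  have "\<exists>!u. u \<in> Hom YY W K\<^sub>Y \<and> l \<cdot>\<^bsub>YY\<^esub> u = h"
    if h: "h \<in> Hom YY W A\<^sub>Y" "y \<cdot>\<^bsub>YY\<^esub> h = Zero YY W B\<^sub>Y" for W h
  proof -
    obtain N where N: "zero_object ZZ N" using Z.zero_ex by blast
    have W: "W \<in> Obj YY" using Y.Hom_Obj[OF h(1)] by simp
    have NO: "N \<in> Obj ZZ" using N by (simp add: zero_object_def)
    let ?W = "(N, W, Zero YY (FObj F N) W)"
    let ?h = "(?W, ?A, Zero ZZ N A\<^sub>Z, h)"
    have "?h \<in> Hom MV ?W ?A"
      using MV_Hom_from_Y[OF N W a] Z.Hom_Obj[OF z] h(1) by blast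
    then have ex1: "\<exists>!u. u \<in> Hom MV ?W ?K \<and> (?K, ?A, k, l) \<cdot>\<^bsub>MV\<^esub> u = ?h"
      using ker h(2) Z.Comp_Zero[OF z NO] NO W Y.Zero_in[OF FObj_in[OF NO] W] MV_Obj_iff by simp
    have lift: "(?W, ?K, Zero ZZ N K\<^sub>Z, v) \<in> Hom MV ?W ?K"
      "(?K, ?A, k, l) \<cdot>\<^bsub>MV\<^esub> (?W, ?K, Zero ZZ N K\<^sub>Z, v) = ?h"
      if "v \<in> Hom YY W K\<^sub>Y" "l \<cdot>\<^bsub>YY\<^esub> v = h" for v
      using MV_Hom_from_Y[OF N W c Z.Hom_Obj(1)[OF k]] Z.Comp_Zero[OF k NO] that by auto
    have "\<exists>v. v \<in> Hom YY W K\<^sub>Y \<and> l \<cdot>\<^bsub>YY\<^esub> v = h"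
      using ex1_implies_ex[OF ex1] by (auto simp: MV_Hom_iff MV_Arr_iff)
    moreover have "v = v'"
      if "v \<in> Hom YY W K\<^sub>Y" "l \<cdot>\<^bsub>YY\<^esub> v = h" "v' \<in> Hom YY W K\<^sub>Y" "l \<cdot>\<^bsub>YY\<^esub> v' = h" for v v'
      using ex1 lift[OF that(1,2)] lift[OF that(3,4)] by (metis Pair_inject)
    ultimately show ?thesis by blast
  qed
  then show "is_kernel YY l y"
    unfolding is_kernel_iff[OF y l] using ker by simp
qed

text \<open>The Z-component is tested through \<open>MV_Hom_to_Z\<close>. The Y-component builds on
  that result: with \<open>q\<close> a cokernel of \<open>z\<close>, also \<open>FArr F q\<close> is
  a cokernel of \<open>FArr F z\<close>, and this supplies the structure map of a test
  object.\<close>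

lemma MV_is_cokernelD:
  assumes "is_cokernel MV ((B\<^sub>Z, B\<^sub>Y, b), (Q\<^sub>Z, Q\<^sub>Y, c), q, r) ((A\<^sub>Z, A\<^sub>Y, a), (B\<^sub>Z, B\<^sub>Y, b), z, y)"
  shows "is_cokernel ZZ q z" "is_cokernel YY r y"
proof -
  let ?A = "(A\<^sub>Z, A\<^sub>Y, a)" and ?B = "(B\<^sub>Z, B\<^sub>Y, b)" and ?Q = "(Q\<^sub>Z, Q\<^sub>Y, c)"
  have m': "(?A, ?B, z, y) \<in> Hom MV ?A ?B" and q': "(?B, ?Q, q, r) \<in> Hom MV ?B ?Q"
    using assms by (auto simp: is_cokernel_def MV_Hom_iff)
  have b: "b \<in> Hom YY (FObj F B\<^sub>Z) B\<^sub>Y" and c: "c \<in> Hom YY (FObj F Q\<^sub>Z) Q\<^sub>Y"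
    and a: "a \<in> Hom YY (FObj F A\<^sub>Z) A\<^sub>Y"
    and z: "z \<in> Hom ZZ A\<^sub>Z B\<^sub>Z" and y: "y \<in> Hom YY A\<^sub>Y B\<^sub>Y"
    and q: "q \<in> Hom ZZ B\<^sub>Z Q\<^sub>Z" and r: "r \<in> Hom YY B\<^sub>Y Q\<^sub>Y"
    and rb: "r \<cdot>\<^bsub>YY\<^esub> b = c \<cdot>\<^bsub>YY\<^esub> FArr F q" and ya: "y \<cdot>\<^bsub>YY\<^esub> a = b \<cdot>\<^bsub>YY\<^esub> FArr F z"
    using m' q' by (auto simp: MV_Arr_iff MV_Hom_iff)
  note coker = assms[unfolded is_cokernel_iff[OF m' q']]
  have "\<exists>!u. u \<in> Hom ZZ Q\<^sub>Z W \<and> u \<cdot>\<^bsub>ZZ\<^esub> q = h"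
    if h: "h \<in> Hom ZZ B\<^sub>Z W" "h \<cdot>\<^bsub>ZZ\<^esub> z = Zero ZZ A\<^sub>Z W" for W h
  proof -
    obtain N where N: "zero_object YY N" using Y.zero_ex by blast
    have W: "W \<in> Obj ZZ" using Z.Hom_Obj[OF h(1)] by simp
    have NO: "N \<in> Obj YY" using N by (simp add: zero_object_def)
    let ?W = "(W, N, Zero YY (FObj F W) N)"
    let ?h = "(?B, ?W, h, Zero YY B\<^sub>Y N)"
    have "?h \<in> Hom MV ?B ?W"
      using MV_Hom_to_Z[OF N W b] h(1) by blast
    then have ex1: "\<exists>!u. u \<in> Hom MV ?Q ?W \<and> u \<cdot>\<^bsub>MV\<^esub> (?B, ?Q, q, r) = ?h"
      using coker h(2) Y.Zero_Comp[OF y NO] NO W Y.Zero_in[OF FObj_in[OF W] NO] MV_Obj_iff by simp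
    have lift: "(?Q, ?W, u, Zero YY Q\<^sub>Y N) \<in> Hom MV ?Q ?W"
      "(?Q, ?W, u, Zero YY Q\<^sub>Y N) \<cdot>\<^bsub>MV\<^esub> (?B, ?Q, q, r) = ?h"
      if "u \<in> Hom ZZ Q\<^sub>Z W" "u \<cdot>\<^bsub>ZZ\<^esub> q = h" for u
      using MV_Hom_to_Z[OF N W c] Y.Zero_Comp[OF r NO] that by auto
    have "\<exists>u. u \<in> Hom ZZ Q\<^sub>Z W \<and> u \<cdot>\<^bsub>ZZ\<^esub> q = h"
      using ex1_implies_ex[OF ex1] by (auto simp: MV_Hom_iff MV_Arr_iff)
    moreover have "u = u'"
      if "u \<in> Hom ZZ Q\<^sub>Z W" "u \<cdot>\<^bsub>ZZ\<^esub> q = h" "u' \<in> Hom ZZ Q\<^sub>Z W" "u' \<cdot>\<^bsub>ZZ\<^esub> q = h" for u u'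
      using ex1 lift[OF that(1,2)] lift[OF that(3,4)] by (metis Pair_inject)
    ultimately show ?thesis by blast
  qed
  then show qz: "is_cokernel ZZ q z"
    unfolding is_cokernel_iff[OF z q] using coker by simp
  note Fq = preserves_cokernel[OF qz]
  have "\<exists>!v. v \<in> Hom YY Q\<^sub>Y W \<and> v \<cdot>\<^bsub>YY\<^esub> r = h"
    if h: "h \<in> Hom YY B\<^sub>Y W" "h \<cdot>\<^bsub>YY\<^esub> y = Zero YY A\<^sub>Y W" for W h
  proof -
    have W: "W \<in> Obj YY" using Y.Hom_Obj[OF h(1)] by simp
    \<comment> \<open>The square for \<open>(z, y)\<close> and the vanishing of \<open>h\<close>
      after \<open>y\<close> show that \<open>h\<close> after \<open>b\<close> kills
      \<open>FArr F z\<close>, so it factors as \<open>g\<close> after \<open>FArr F q\<close>. With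
      \<open>g\<close> as structure map, \<open>(Q\<^sub>Z, W, g)\<close> receives the arrow
      \<open>(q, h)\<close> from \<open>?B\<close>, whose composite with \<open>(z, y)\<close> is
      zero.\<close>
    have "(h \<cdot>\<^bsub>YY\<^esub> b) \<cdot>\<^bsub>YY\<^esub> FArr F z = Zero YY (FObj F A\<^sub>Z) W"
      using Y.Comp_assoc[OF FArr_in[OF z] b h(1)] Y.Comp_assoc[OF a y h(1)] ya h(2)
        Y.Zero_Comp[OF a W] by simp
    then obtain g where g: "g \<in> Hom YY (FObj F Q\<^sub>Z) W" "g \<cdot>\<^bsub>YY\<^esub> FArr F q = h \<cdot>\<^bsub>YY\<^esub> b"
      using Fq Y.Comp_in[OF b h(1)] W unfolding is_cokernel_iff[OF FArr_in[OF z] FArr_in[OF q]]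
      by metis
    let ?W = "(Q\<^sub>Z, W, g)"
    have QZ: "Q\<^sub>Z \<in> Obj ZZ" and i: "Id ZZ Q\<^sub>Z \<in> Hom ZZ Q\<^sub>Z Q\<^sub>Z"
      using Z.Hom_Obj[OF q] Z.Id_in by auto
    have "(?B, ?W, q, h) \<in> Hom MV ?B ?W"
      using b g q h(1) by (simp add: MV_Hom_iff MV_Arr_iff)
    then have ex1: "\<exists>!u. u \<in> Hom MV ?Q ?W \<and> u \<cdot>\<^bsub>MV\<^esub> (?B, ?Q, q, r) = (?B, ?W, q, h)"
      using coker h(2) W QZ g(1) MV_Obj_iff by simp
    \<comment> \<open>A factorization \<open>v\<close> of \<open>h\<close>, paired with the identity
      of \<open>Q\<^sub>Z\<close>, respects the structure maps, because both sides agree after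
      precomposing with the epic \<open>FArr F q\<close>. Distinct \<open>v\<close> would thus give
      distinct factorizations in \<open>MV\<close>.\<close>
    have lift: "(?Q, ?W, Id ZZ Q\<^sub>Z, v) \<in> Hom MV ?Q ?W"
      "(?Q, ?W, Id ZZ Q\<^sub>Z, v) \<cdot>\<^bsub>MV\<^esub> (?B, ?Q, q, r) = (?B, ?W, q, h)"
      if v: "v \<in> Hom YY Q\<^sub>Y W" "v \<cdot>\<^bsub>YY\<^esub> r = h" for v
    proof -
      have "(v \<cdot>\<^bsub>YY\<^esub> c) \<cdot>\<^bsub>YY\<^esub> FArr F q = g \<cdot>\<^bsub>YY\<^esub> FArr F q"
        using Y.Comp_assoc[OF FArr_in[OF q] c v(1)] Y.Comp_assoc[OF b r v(1)] v g rb by simp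
      then have "v \<cdot>\<^bsub>YY\<^esub> c = g"
        using Y.is_cokernel_epic[OF Fq] Y.Comp_in[OF c v(1)] g(1) W FArr_in[OF q]
        unfolding epic_def by (auto simp: Hom_Cod)
      then show "(?Q, ?W, Id ZZ Q\<^sub>Z, v) \<in> Hom MV ?Q ?W"
        using v c g i QZ FArr_Id Y.Comp_Id by (simp add: MV_Hom_iff MV_Arr_iff)
      show "(?Q, ?W, Id ZZ Q\<^sub>Z, v) \<cdot>\<^bsub>MV\<^esub> (?B, ?Q, q, r) = (?B, ?W, q, h)"
        using v Z.Id_Comp[OF q] by simp
    qed
    have "\<exists>v. v \<in> Hom YY Q\<^sub>Y W \<and> v \<cdot>\<^bsub>YY\<^esub> r = h"
      using ex1_implies_ex[OF ex1] by (auto simp: MV_Hom_iff MV_Arr_iff)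
    moreover have "v = v'"
      if "v \<in> Hom YY Q\<^sub>Y W" "v \<cdot>\<^bsub>YY\<^esub> r = h" "v' \<in> Hom YY Q\<^sub>Y W" "v' \<cdot>\<^bsub>YY\<^esub> r = h" for v v'
      using ex1 lift[OF that(1,2)] lift[OF that(3,4)] by (metis Pair_inject)
    ultimately show ?thesis by blast
  qed
  then show "is_cokernel YY r y"
    unfolding is_cokernel_iff[OF y r] using coker by simp
qed

section \<open>Monomorphisms and zero objects\<close>

text \<open>Forward, parallel arrows into a component are transposed as in
  \<open>MV_is_kernelD\<close> and cancelled in \<open>MV\<close>; the converse cancels in each
  component.\<close>

lemma MV_monic_iff:
  assumes "((A\<^sub>Z, A\<^sub>Y, a), (B\<^sub>Z, B\<^sub>Y, b), z, y) \<in> Arr MV"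
  shows "monic MV ((A\<^sub>Z, A\<^sub>Y, a), (B\<^sub>Z, B\<^sub>Y, b), z, y) \<longleftrightarrow> monic ZZ z \<and> monic YY y"
proof
  let ?A = "(A\<^sub>Z, A\<^sub>Y, a)" and ?B = "(B\<^sub>Z, B\<^sub>Y, b)"
  have m': "(?A, ?B, z, y) \<in> Hom MV ?A ?B"
    using assms by (auto simp: MV_Hom_iff)
  have a: "a \<in> Hom YY (FObj F A\<^sub>Z) A\<^sub>Y" and b: "b \<in> Hom YY (FObj F B\<^sub>Z) B\<^sub>Y"
    and z: "z \<in> Hom ZZ A\<^sub>Z B\<^sub>Z" and y: "y \<in> Hom YY A\<^sub>Y B\<^sub>Y"
    and ya: "y \<cdot>\<^bsub>YY\<^esub> a = b \<cdot>\<^bsub>YY\<^esub> FArr F z"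
    using assms by (auto simp: MV_Arr_iff)
  {
    assume "monic MV (?A, ?B, z, y)"
    note mon = this[unfolded monic_iff[OF m'], rule_format]
    have "g = h" if gh: "g \<in> Hom ZZ W A\<^sub>Z" "h \<in> Hom ZZ W A\<^sub>Z" "z \<cdot>\<^bsub>ZZ\<^esub> g = z \<cdot>\<^bsub>ZZ\<^esub> h" for W g h
    proof -
      have W: "W \<in> Obj ZZ" using Z.Hom_Obj[OF gh(1)] by simp
      let ?W = "(W, FObj F W, Id YY (FObj F W))"
      have "y \<cdot>\<^bsub>YY\<^esub> (a \<cdot>\<^bsub>YY\<^esub> FArr F g) = y \<cdot>\<^bsub>YY\<^esub> (a \<cdot>\<^bsub>YY\<^esub> FArr F h)"
        using Y.Comp_assoc[OF FArr_in[OF gh(1)] a y] Y.Comp_assoc[OF FArr_in[OF gh(2)] a y]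
          Y.Comp_assoc[OF FArr_in[OF gh(1)] FArr_in[OF z] b]
          Y.Comp_assoc[OF FArr_in[OF gh(2)] FArr_in[OF z] b]
          FArr_Comp[OF gh(1) z] FArr_Comp[OF gh(2) z] gh(3) ya by simp
      then show ?thesis
        using mon[of ?W "(?W, ?A, g, a \<cdot>\<^bsub>YY\<^esub> FArr F g)" "(?W, ?A, h, a \<cdot>\<^bsub>YY\<^esub> FArr F h)"] gh
          MV_Hom_free[OF W a] MV_Obj_iff W FObj_in[OF W] Y.Id_in by auto
    qed
    moreover have "g = h"
      if gh: "g \<in> Hom YY W A\<^sub>Y" "h \<in> Hom YY W A\<^sub>Y" "y \<cdot>\<^bsub>YY\<^esub> g = y \<cdot>\<^bsub>YY\<^esub> h" for W g h
    proof -
      obtain N where N: "zero_object ZZ N" using Z.zero_ex by blast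
      have W: "W \<in> Obj YY" using Y.Hom_Obj[OF gh(1)] by simp
      have NO: "N \<in> Obj ZZ" using N by (simp add: zero_object_def)
      let ?W = "(N, W, Zero YY (FObj F N) W)"
      show ?thesis
        using mon[of ?W "(?W, ?A, Zero ZZ N A\<^sub>Z, g)" "(?W, ?A, Zero ZZ N A\<^sub>Z, h)"] gh
          MV_Hom_from_Y[OF N W a Z.Hom_Obj(1)[OF z]] MV_Obj_iff W FObj_in[OF NO] NO by auto
    qed
    ultimately show "monic ZZ z \<and> monic YY y"
      unfolding monic_iff[OF z] monic_iff[OF y] by blast
  }
  assume mon: "monic ZZ z \<and> monic YY y"
  have "g = h" if "g \<in> Hom MV W ?A" "h \<in> Hom MV W ?A"
    and eq: "(?A, ?B, z, y) \<cdot>\<^bsub>MV\<^esub> g = (?A, ?B, z, y) \<cdot>\<^bsub>MV\<^esub> h" for W g h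
  proof -
    obtain W\<^sub>Z W\<^sub>Y w where W: "W = (W\<^sub>Z, W\<^sub>Y, w)" by (metis prod_cases3)
    obtain g\<^sub>Z g\<^sub>Y h\<^sub>Z h\<^sub>Y where gh: "g = (W, ?A, g\<^sub>Z, g\<^sub>Y)" "h = (W, ?A, h\<^sub>Z, h\<^sub>Y)"
      and homs: "g\<^sub>Z \<in> Hom ZZ W\<^sub>Z A\<^sub>Z" "h\<^sub>Z \<in> Hom ZZ W\<^sub>Z A\<^sub>Z" "g\<^sub>Y \<in> Hom YY W\<^sub>Y A\<^sub>Y" "h\<^sub>Y \<in> Hom YY W\<^sub>Y A\<^sub>Y"
      using \<open>g \<in> _\<close> \<open>h \<in> _\<close> by (auto simp: W MV_Hom_iff MV_Arr_iff)
    have "z \<cdot>\<^bsub>ZZ\<^esub> g\<^sub>Z = z \<cdot>\<^bsub>ZZ\<^esub> h\<^sub>Z" "y \<cdot>\<^bsub>YY\<^esub> g\<^sub>Y = y \<cdot>\<^bsub>YY\<^esub> h\<^sub>Y"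
      using eq by (simp_all add: gh)
    then show ?thesis
      using mon homs Z.Hom_Obj[OF homs(1)] Y.Hom_Obj[OF homs(3)]
      unfolding monic_iff[OF z] monic_iff[OF y] gh by blast
  qed
  then show "monic MV (?A, ?B, z, y)"
    unfolding monic_iff[OF m'] by blast
qed

lemma MV_Zero_in:
  assumes "S \<in> Obj MV" "T \<in> Obj MV"
  shows "Zero MV S T \<in> Hom MV S T"
proof -
  obtain Z Y f Z' Y' f' where S: "S = (Z, Y, f)" and T: "T = (Z', Y', f')"
    by (metis prod_cases3)
  have f: "f \<in> Hom YY (FObj F Z) Y" and f': "f' \<in> Hom YY (FObj F Z') Y'"
    and objs: "Z \<in> Obj ZZ" "Z' \<in> Obj ZZ" "Y \<in> Obj YY" "Y' \<in> Obj YY"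
    using assms by (auto simp: S T MV_Obj_iff)
  then show ?thesis
    using Y.Zero_Comp[OF f] Y.Comp_Zero[OF f'] FArr_Zero FObj_in
    by (simp add: S T MV_Hom_iff MV_Arr_iff)
qed

text \<open>Forward, the identity and the zero arrow of the triple coincide, and the components of
  this equation are the criterion \<open>zero_object_iff_Id\<close>. Conversely, arrows to and from
  the triple have unique components.\<close>

lemma MV_zero_object_iff:
  "zero_object MV (Z, Y, f) \<longleftrightarrow> f \<in> Hom YY (FObj F Z) Y \<and> zero_object ZZ Z \<and> zero_object YY Y"
proof
  let ?S = "(Z, Y, f)"
  assume zero: "zero_object MV ?S"
  then have S: "?S \<in> Obj MV" by (simp add: zero_object_def)
  then have f: "f \<in> Hom YY (FObj F Z) Y" and objs: "Z \<in> Obj ZZ" "Y \<in> Obj YY"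
    by (auto simp: MV_Obj_iff)
  have "(?S, ?S, Id ZZ Z, Id YY Y) \<in> Hom MV ?S ?S"
    using f objs Z.Id_in Y.Id_in FArr_Id Y.Id_Comp[OF f] Y.Comp_Id[OF f]
    by (simp add: MV_Hom_iff MV_Arr_iff)
  then have "(?S, ?S, Id ZZ Z, Id YY Y) = Zero MV ?S ?S"
    using zero MV_Zero_in[OF S S] S unfolding zero_object_def by blast
  then show "f \<in> Hom YY (FObj F Z) Y \<and> zero_object ZZ Z \<and> zero_object YY Y"
    using f objs by (simp add: Z.zero_object_iff_Id Y.zero_object_iff_Id)
next
  let ?S = "(Z, Y, f)"
  assume zero: "f \<in> Hom YY (FObj F Z) Y \<and> zero_object ZZ Z \<and> zero_object YY Y"
  then have S: "?S \<in> Obj MV"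
    by (auto simp: MV_Obj_iff zero_object_def)
  have "g = h" if "g \<in> Hom MV ?S T" "h \<in> Hom MV ?S T" for T g h
  proof -
    obtain Z' Y' f' where T: "T = (Z', Y', f')" by (metis prod_cases3)
    show ?thesis
      using that zero Z.zero_object_Hom_eqI[of Z Z'] Y.zero_object_Hom_eqI[of Y Y']
      unfolding T MV_Hom_iff MV_Arr_iff by blast
  qed
  moreover have "g = h" if "g \<in> Hom MV T ?S" "h \<in> Hom MV T ?S" for T g h
  proof -
    obtain Z' Y' f' where T: "T = (Z', Y', f')" by (metis prod_cases3)
    show ?thesis
      using that zero Z.zero_object_Hom_eqI[of Z' Z] Y.zero_object_Hom_eqI[of Y' Y]
      unfolding T MV_Hom_iff MV_Arr_iff by blast
  qed
  ultimately show "zero_object MV ?S"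
    unfolding zero_object_def using S MV_Zero_in by metis
qed

section \<open>The embeddings of \<open>\<Y>\<close> and \<open>\<Z>\<close>\<close>

text \<open>The zero object \<open>N\<close> is a parameter so that a triple whose Y-component is
  any zero object is literally an embedded object.\<close>

definition embZ_Obj :: "'o \<Rightarrow> 'p \<Rightarrow> 'p \<times> 'o \<times> 'a" where
  "embZ_Obj N Z = (Z, N, Zero YY (FObj F Z) N)"

definition embY_Obj :: "'p \<Rightarrow> 'o \<Rightarrow> 'p \<times> 'o \<times> 'a" where
  "embY_Obj N Y = (N, Y, Zero YY (FObj F N) Y)"

text \<open>For a zero object \<open>N\<close> the arrow \<open>Zero YY N N\<close> is also the
  identity of \<open>N\<close>, as functoriality requires.\<close>

definition embZ :: "'o \<Rightarrow> 'b \<Rightarrow> ('p \<times> 'o \<times> 'a) \<times> ('p \<times> 'o \<times> 'a) \<times> 'b \<times> 'a" where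
  "embZ N z = (embZ_Obj N (Dom ZZ z), embZ_Obj N (Cod ZZ z), z, Zero YY N N)"

definition embY :: "'p \<Rightarrow> 'a \<Rightarrow> ('p \<times> 'o \<times> 'a) \<times> ('p \<times> 'o \<times> 'a) \<times> 'b \<times> 'a" where
  "embY N y = (embY_Obj N (Dom YY y), embY_Obj N (Cod YY y), Zero ZZ N N, y)"

lemma Dom_emb [simp]: "Dom MV (embZ N z) = embZ_Obj N (Dom ZZ z)" "Dom MV (embY M y) = embY_Obj M (Dom YY y)"
  and Cod_emb [simp]: "Cod MV (embZ N z) = embZ_Obj N (Cod ZZ z)" "Cod MV (embY M y) = embY_Obj M (Cod YY y)"
  by (simp_all add: embZ_def embY_def)

context
  fixes N assumes N: "zero_object YY N"
begin

lemma embZ_in: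
  assumes z: "z \<in> Hom ZZ Z Z'"
  shows "embZ N z \<in> Hom MV (embZ_Obj N Z) (embZ_Obj N Z')"
  using MV_Hom_to_Z[OF N Z.Hom_Obj(2)[OF z] Y.Zero_in[OF FObj_in[OF Z.Hom_Obj(1)[OF z]] zero_object_Obj[OF N]]] z
  unfolding embZ_def embZ_Obj_def Hom_Dom[OF z] Hom_Cod[OF z] by blast

lemma embZ_Arr: "z \<in> Arr ZZ \<Longrightarrow> embZ N z \<in> Arr MV"
  by (rule Hom_Arr[OF embZ_in[OF Arr_Hom]])

text \<open>The zero endomorphism of \<open>N\<close> is its identity, hence a kernel and a cokernel
  of itself; this fills the idle component when kernels and cokernels are embedded.\<close>

lemma short_exact_Zero_YY: "short_exact YY (Zero YY N N) (Zero YY N N)"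
  using Y.short_exact_Id_Zero[OF zero_object_Obj[OF N] N] N by (simp add: Y.zero_object_iff_Id)

lemma is_kernel_embZ:
  assumes "is_kernel ZZ k z"
  shows "is_kernel MV (embZ N k) (embZ N z)"
proof -
  have "k \<in> Arr ZZ" "z \<in> Arr ZZ" and eq: "Cod ZZ k = Dom ZZ z"
    using assms by (auto simp: is_kernel_def)
  then show ?thesis
    using MV_is_kernelI[OF embZ_Arr[of z, unfolded embZ_def embZ_Obj_def]
        embZ_Arr[of k, unfolded embZ_def embZ_Obj_def eq] assms] short_exact_Zero_YY
    by (simp add: embZ_def embZ_Obj_def short_exact_def eq)
qed

lemma is_cokernel_embZ:
  assumes "is_cokernel ZZ q z"
  shows "is_cokernel MV (embZ N q) (embZ N z)"
proof -
  have "q \<in> Arr ZZ" "z \<in> Arr ZZ" and eq: "Dom ZZ q = Cod ZZ z"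
    using assms by (auto simp: is_cokernel_def)
  then show ?thesis
    using MV_is_cokernelI[OF embZ_Arr[of z, unfolded embZ_def embZ_Obj_def]
        embZ_Arr[of q, unfolded embZ_def embZ_Obj_def eq] assms] short_exact_Zero_YY
    by (simp add: embZ_def embZ_Obj_def short_exact_def eq)
qed

lemma short_exact_embZ: "short_exact ZZ f g \<Longrightarrow> short_exact MV (embZ N f) (embZ N g)"
  using is_kernel_embZ is_cokernel_embZ by (simp add: short_exact_def)

lemma monic_embZ:
  assumes "z \<in> Arr ZZ"
  shows "monic MV (embZ N z) \<longleftrightarrow> monic ZZ z"
  using MV_monic_iff[OF embZ_Arr[OF assms, unfolded embZ_def embZ_Obj_def]] N zero_object_Obj[OF N]
    Y.monic_if_zero_object[OF N Y.Zero_in] by (simp add: embZ_def embZ_Obj_def)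

lemma zero_object_embZ_Obj: "zero_object MV (embZ_Obj N Z) \<longleftrightarrow> zero_object ZZ Z"
  using N zero_object_Obj[OF N] FObj_in by (auto simp: embZ_Obj_def MV_zero_object_iff zero_object_def[of ZZ])

end

context
  fixes N assumes N: "zero_object ZZ N"
begin

lemma embY_in:
  assumes y: "y \<in> Hom YY Y Y'"
  shows "embY N y \<in> Hom MV (embY_Obj N Y) (embY_Obj N Y')"
  using MV_Hom_from_Y[OF N Y.Hom_Obj(1)[OF y] Y.Zero_in[OF FObj_in[OF zero_object_Obj[OF N]] Y.Hom_Obj(2)[OF y]] zero_object_Obj[OF N]] y
  unfolding embY_def embY_Obj_def Hom_Dom[OF y] Hom_Cod[OF y] by blast

lemma embY_Arr: "y \<in> Arr YY \<Longrightarrow> embY N y \<in> Arr MV"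
  by (rule Hom_Arr[OF embY_in[OF Arr_Hom]])

lemma short_exact_Zero_ZZ: "short_exact ZZ (Zero ZZ N N) (Zero ZZ N N)"
  using Z.short_exact_Id_Zero[OF zero_object_Obj[OF N] N] N by (simp add: Z.zero_object_iff_Id)

lemma is_kernel_embY:
  assumes "is_kernel YY k y"
  shows "is_kernel MV (embY N k) (embY N y)"
proof -
  have "k \<in> Arr YY" "y \<in> Arr YY" and eq: "Cod YY k = Dom YY y"
    using assms by (auto simp: is_kernel_def)
  then show ?thesis
    using MV_is_kernelI[OF embY_Arr[of y, unfolded embY_def embY_Obj_def]
        embY_Arr[of k, unfolded embY_def embY_Obj_def eq] _ assms] short_exact_Zero_ZZ
    by (simp add: embY_def embY_Obj_def short_exact_def eq)
qed

lemma is_cokernel_embY: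
  assumes "is_cokernel YY q y"
  shows "is_cokernel MV (embY N q) (embY N y)"
proof -
  have "q \<in> Arr YY" "y \<in> Arr YY" and eq: "Dom YY q = Cod YY y"
    using assms by (auto simp: is_cokernel_def)
  then show ?thesis
    using MV_is_cokernelI[OF embY_Arr[of y, unfolded embY_def embY_Obj_def]
        embY_Arr[of q, unfolded embY_def embY_Obj_def eq] _ assms] short_exact_Zero_ZZ
    by (simp add: embY_def embY_Obj_def short_exact_def eq)
qed

lemma short_exact_embY: "short_exact YY f g \<Longrightarrow> short_exact MV (embY N f) (embY N g)"
  using is_kernel_embY is_cokernel_embY by (simp add: short_exact_def)

lemma monic_embY:
  assumes "y \<in> Arr YY"
  shows "monic MV (embY N y) \<longleftrightarrow> monic YY y"
  using MV_monic_iff[OF embY_Arr[OF assms, unfolded embY_def embY_Obj_def]] N zero_object_Obj[OF N]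
    Z.monic_if_zero_object[OF N Z.Zero_in] by (simp add: embY_def embY_Obj_def)

lemma zero_object_embY_Obj: "zero_object MV (embY_Obj N Y) \<longleftrightarrow> zero_object YY Y"
  using N zero_object_Obj[OF N] FObj_in by (auto simp: embY_Obj_def MV_zero_object_iff zero_object_def[of YY])

end

section \<open>Exact sequences in coordinates\<close>

lemma is_kernel_MV_cases:
  assumes "is_kernel MV m n"
  obtains K\<^sub>Z K\<^sub>Y c A\<^sub>Z A\<^sub>Y a B\<^sub>Z B\<^sub>Y b k l z y where
    "m = ((K\<^sub>Z, K\<^sub>Y, c), (A\<^sub>Z, A\<^sub>Y, a), k, l)" "n = ((A\<^sub>Z, A\<^sub>Y, a), (B\<^sub>Z, B\<^sub>Y, b), z, y)"
    "is_kernel ZZ k z" "is_kernel YY l y"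
    "((K\<^sub>Z, K\<^sub>Y, c), (A\<^sub>Z, A\<^sub>Y, a), k, l) \<in> Arr MV" "((A\<^sub>Z, A\<^sub>Y, a), (B\<^sub>Z, B\<^sub>Y, b), z, y) \<in> Arr MV"
proof -
  have arr: "m \<in> Arr MV" "n \<in> Arr MV" and eq: "Cod MV m = Dom MV n"
    using assms by (auto simp: is_kernel_def)
  from arr(1) obtain K\<^sub>Z K\<^sub>Y c A\<^sub>Z A\<^sub>Y a k l where m: "m = ((K\<^sub>Z, K\<^sub>Y, c), (A\<^sub>Z, A\<^sub>Y, a), k, l)"
    by (rule MV_Arr_cases)
  from arr(2) eq obtain B\<^sub>Z B\<^sub>Y b z y where n: "n = ((A\<^sub>Z, A\<^sub>Y, a), (B\<^sub>Z, B\<^sub>Y, b), z, y)"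
    by (auto simp: m elim: MV_Arr_cases)
  show thesis
    using that[OF m n] MV_is_kernelD assms arr by (simp add: m n)
qed

lemma is_cokernel_MV_cases:
  assumes "is_cokernel MV m n"
  obtains A\<^sub>Z A\<^sub>Y a B\<^sub>Z B\<^sub>Y b Q\<^sub>Z Q\<^sub>Y c q r z y where
    "m = ((B\<^sub>Z, B\<^sub>Y, b), (Q\<^sub>Z, Q\<^sub>Y, c), q, r)" "n = ((A\<^sub>Z, A\<^sub>Y, a), (B\<^sub>Z, B\<^sub>Y, b), z, y)"
    "is_cokernel ZZ q z" "is_cokernel YY r y"
    "((B\<^sub>Z, B\<^sub>Y, b), (Q\<^sub>Z, Q\<^sub>Y, c), q, r) \<in> Arr MV" "((A\<^sub>Z, A\<^sub>Y, a), (B\<^sub>Z, B\<^sub>Y, b), z, y) \<in> Arr MV"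
proof -
  have arr: "m \<in> Arr MV" "n \<in> Arr MV" and eq: "Dom MV m = Cod MV n"
    using assms by (auto simp: is_cokernel_def)
  from arr(2) obtain A\<^sub>Z A\<^sub>Y a B\<^sub>Z B\<^sub>Y b z y where n: "n = ((A\<^sub>Z, A\<^sub>Y, a), (B\<^sub>Z, B\<^sub>Y, b), z, y)"
    by (rule MV_Arr_cases)
  from arr(1) eq obtain Q\<^sub>Z Q\<^sub>Y c q r where m: "m = ((B\<^sub>Z, B\<^sub>Y, b), (Q\<^sub>Z, Q\<^sub>Y, c), q, r)"
    by (auto simp: n elim: MV_Arr_cases)
  show thesis
    using that[OF m n] MV_is_cokernelD assms arr by (simp add: m n)
qed

lemma short_exact_MV_cases:
  assumes "short_exact MV m n"
  obtains L\<^sub>Z L\<^sub>Y c M\<^sub>Z M\<^sub>Y a R\<^sub>Z R\<^sub>Y b f\<^sub>Z f\<^sub>Y g\<^sub>Z g\<^sub>Y where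
    "m = ((L\<^sub>Z, L\<^sub>Y, c), (M\<^sub>Z, M\<^sub>Y, a), f\<^sub>Z, f\<^sub>Y)" "n = ((M\<^sub>Z, M\<^sub>Y, a), (R\<^sub>Z, R\<^sub>Y, b), g\<^sub>Z, g\<^sub>Y)"
    "short_exact ZZ f\<^sub>Z g\<^sub>Z" "short_exact YY f\<^sub>Y g\<^sub>Y"
    "((L\<^sub>Z, L\<^sub>Y, c), (M\<^sub>Z, M\<^sub>Y, a), f\<^sub>Z, f\<^sub>Y) \<in> Arr MV" "((M\<^sub>Z, M\<^sub>Y, a), (R\<^sub>Z, R\<^sub>Y, b), g\<^sub>Z, g\<^sub>Y) \<in> Arr MV"
proof -
  have ker: "is_kernel MV m n" and coker: "is_cokernel MV n m"
    using assms by (auto simp: short_exact_def)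
  from ker show thesis
    by (rule is_kernel_MV_cases)
      (use that coker MV_is_cokernelD in \<open>simp add: short_exact_def\<close>)
qed

text \<open>Exactness is degenerate in each component: \<open>N', Z, Z\<close> over one category and
  \<open>Y, Y, N\<close> over the other. The squares commute for every \<open>f\<close>, since one
  starts at the zero object \<open>FObj F N'\<close> and the other ends at \<open>N\<close>.\<close>

lemma short_exact_MV_split:
  assumes "f \<in> Hom YY (FObj F Z) Y" "Z \<in> Obj ZZ" "zero_object YY N" "zero_object ZZ N'"
  shows "short_exact MV (embY_Obj N' Y, (Z, Y, f), Zero ZZ N' Z, Id YY Y)
           ((Z, Y, f), embZ_Obj N Z, Id ZZ Z, Zero YY Y N)"
proof -
  have Y: "Y \<in> Obj YY"
    using Y.Hom_Obj assms(1) by blast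
  let ?L = "(N', Y, Zero YY (FObj F N') Y)" and ?M = "(Z, Y, f)" and ?R = "(Z, N, Zero YY (FObj F Z) N)"
  have "(?L, ?M, Zero ZZ N' Z, Id YY Y) \<in> Hom MV ?L ?M"
    using MV_Hom_from_Y[OF assms(4) Y assms(1,2)] Y.Id_in[OF Y] by blast
  then have i: "(?L, ?M, Zero ZZ N' Z, Id YY Y) \<in> Arr MV"
    by (rule Hom_Arr)
  have "(?M, ?R, Id ZZ Z, Zero YY Y N) \<in> Hom MV ?M ?R"
    using MV_Hom_to_Z[OF assms(3,2,1)] Z.Id_in[OF assms(2)] by blast
  then have p: "(?M, ?R, Id ZZ Z, Zero YY Y N) \<in> Arr MV"
    by (rule Hom_Arr)
  show ?thesis
    using MV_is_kernelI[OF p i] MV_is_cokernelI[OF i p] Z.short_exact_Zero_Id[OF assms(2,4)]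
      Y.short_exact_Id_Zero[OF Y assms(3)]
    by (simp add: short_exact_def embY_Obj_def embZ_Obj_def)
qed

end


section \<open>Transfer of the closure properties\<close>

locale macpherson_vilonen_sub = macpherson_vilonen ZZ YY F
  for ZZ :: "('p, 'b) precat" and YY :: "('o, 'a) precat" and F :: "('p, 'b, 'o, 'a) cfunctor" +
  fixes E\<^sub>Y :: "'o set" and E\<^sub>Z :: "'p set"
  assumes sub_Y: "subcategory YY E\<^sub>Y" and sub_Z: "subcategory ZZ E\<^sub>Z"
begin

abbreviation "E\<^sub>X \<equiv> MV_sub YY ZZ F E\<^sub>Y E\<^sub>Z"

lemma E\<^sub>X_iff: "(Z, Y, f) \<in> E\<^sub>X \<longleftrightarrow> f \<in> Hom YY (FObj F Z) Y \<and> Z \<in> E\<^sub>Z \<and> Y \<in> E\<^sub>Y"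
  using sub_Y sub_Z by (auto simp: MV_sub_def MV_Obj_iff subcategory_def)

text \<open>A triple at the end of an arrow of \<open>MV\<close> has a well-typed structure map, so
  membership in \<open>E\<^sub>X\<close> concerns its two objects only.\<close>

lemma E\<^sub>X_if_Arr:
  assumes "((Z, Y, f), (Z', Y', f'), z, y) \<in> Arr MV"
  shows "(Z, Y, f) \<in> E\<^sub>X \<longleftrightarrow> Z \<in> E\<^sub>Z \<and> Y \<in> E\<^sub>Y" "(Z', Y', f') \<in> E\<^sub>X \<longleftrightarrow> Z' \<in> E\<^sub>Z \<and> Y' \<in> E\<^sub>Y"
    and "Dom ZZ z = Z" "Cod ZZ z = Z'" "Dom YY y = Y" "Cod YY y = Y'"
  using assms by (auto simp: E\<^sub>X_iff MV_Arr_iff Hom_def)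

lemma sub_Obj: "Y \<in> E\<^sub>Y \<Longrightarrow> Y \<in> Obj YY" "Z \<in> E\<^sub>Z \<Longrightarrow> Z \<in> Obj ZZ"
  using sub_Y sub_Z by (auto simp: subcategory_def)

lemma embZ_Obj_E\<^sub>X:
  assumes "N \<in> E\<^sub>Y"
  shows "embZ_Obj N Z \<in> E\<^sub>X \<longleftrightarrow> Z \<in> E\<^sub>Z"
  using assms sub_Obj FObj_in by (auto simp: embZ_Obj_def E\<^sub>X_iff)

lemma embY_Obj_E\<^sub>X:
  assumes "N \<in> E\<^sub>Z"
  shows "embY_Obj N Y \<in> E\<^sub>X \<longleftrightarrow> Y \<in> E\<^sub>Y"
  using assms sub_Obj FObj_in by (auto simp: embY_Obj_def E\<^sub>X_iff)

text \<open>Taking the zero objects inside the subcategories keeps embedded objects inside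
  \<open>E\<^sub>X\<close>.\<close>

lemma zero_objects:
  obtains N N' where "N \<in> E\<^sub>Y" "zero_object YY N" "N' \<in> E\<^sub>Z" "zero_object ZZ N'"
  using sub_Y sub_Z by (auto simp: subcategory_def)

section \<open>Extensions, kernels, cokernels and subobjects\<close>

lemma extension_closed_MV:
  "extension_closed MV E\<^sub>X \<longleftrightarrow> extension_closed YY E\<^sub>Y \<and> extension_closed ZZ E\<^sub>Z"
proof
  obtain N N' where N: "N \<in> E\<^sub>Y" "zero_object YY N" and N': "N' \<in> E\<^sub>Z" "zero_object ZZ N'"
    by (rule zero_objects)
  assume X: "extension_closed MV E\<^sub>X"
  have "Cod YY f \<in> E\<^sub>Y" if "short_exact YY f g" "Dom YY f \<in> E\<^sub>Y" "Cod YY g \<in> E\<^sub>Y" for f g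
    using X[unfolded extension_closed_def, rule_format, of "embY N' f" "embY N' g"] that
      short_exact_embY[OF N'(2)] embY_Obj_E\<^sub>X[OF N'(1)] by simp
  moreover have "Cod ZZ f \<in> E\<^sub>Z" if "short_exact ZZ f g" "Dom ZZ f \<in> E\<^sub>Z" "Cod ZZ g \<in> E\<^sub>Z" for f g
    using X[unfolded extension_closed_def, rule_format, of "embZ N f" "embZ N g"] that
      short_exact_embZ[OF N(2)] embZ_Obj_E\<^sub>X[OF N(1)] by simp
  ultimately show "extension_closed YY E\<^sub>Y \<and> extension_closed ZZ E\<^sub>Z"
    unfolding extension_closed_def by blast
next
  assume YZ: "extension_closed YY E\<^sub>Y \<and> extension_closed ZZ E\<^sub>Z"
  have "Cod MV m \<in> E\<^sub>X" if "short_exact MV m n" and E: "Dom MV m \<in> E\<^sub>X" "Cod MV n \<in> E\<^sub>X" for m n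
    using that(1)
  proof (cases rule: short_exact_MV_cases)
    case (1 L\<^sub>Z L\<^sub>Y c M\<^sub>Z M\<^sub>Y a R\<^sub>Z R\<^sub>Y b f\<^sub>Z f\<^sub>Y g\<^sub>Z g\<^sub>Y)
    then show ?thesis
      using E YZ[unfolded extension_closed_def] E\<^sub>X_if_Arr[OF 1(5)] E\<^sub>X_if_Arr[OF 1(6)]
      by (metis MV_Cod MV_Dom)
  qed
  then show "extension_closed MV E\<^sub>X"
    unfolding extension_closed_def by blast
qed

lemma kernel_closed_MV: "kernel_closed MV E\<^sub>X \<longleftrightarrow> kernel_closed YY E\<^sub>Y \<and> kernel_closed ZZ E\<^sub>Z"
proof
  obtain N N' where N: "N \<in> E\<^sub>Y" "zero_object YY N" and N': "N' \<in> E\<^sub>Z" "zero_object ZZ N'"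
    by (rule zero_objects)
  assume X: "kernel_closed MV E\<^sub>X"
  have "Dom YY k \<in> E\<^sub>Y" if "is_kernel YY k f" "Dom YY f \<in> E\<^sub>Y" "Cod YY f \<in> E\<^sub>Y" for f k
    using X[unfolded kernel_closed_def, rule_format, of "embY N' k" "embY N' f"] that
      is_kernel_embY[OF N'(2)] embY_Obj_E\<^sub>X[OF N'(1)] by simp
  moreover have "Dom ZZ k \<in> E\<^sub>Z" if "is_kernel ZZ k f" "Dom ZZ f \<in> E\<^sub>Z" "Cod ZZ f \<in> E\<^sub>Z" for f k
    using X[unfolded kernel_closed_def, rule_format, of "embZ N k" "embZ N f"] that
      is_kernel_embZ[OF N(2)] embZ_Obj_E\<^sub>X[OF N(1)] by simp
  ultimately show "kernel_closed YY E\<^sub>Y \<and> kernel_closed ZZ E\<^sub>Z"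
    unfolding kernel_closed_def by blast
next
  assume YZ: "kernel_closed YY E\<^sub>Y \<and> kernel_closed ZZ E\<^sub>Z"
  have "Dom MV m \<in> E\<^sub>X" if "is_kernel MV m n" and E: "Dom MV n \<in> E\<^sub>X" "Cod MV n \<in> E\<^sub>X" for m n
    using that(1)
  proof (cases rule: is_kernel_MV_cases)
    case (1 K\<^sub>Z K\<^sub>Y c A\<^sub>Z A\<^sub>Y a B\<^sub>Z B\<^sub>Y b k l z y)
    then show ?thesis
      using E YZ[unfolded kernel_closed_def] E\<^sub>X_if_Arr[OF 1(5)] E\<^sub>X_if_Arr[OF 1(6)]
      by (metis MV_Cod MV_Dom)
  qed
  then show "kernel_closed MV E\<^sub>X"
    unfolding kernel_closed_def by blast
qed

lemma cokernel_closed_MV: "cokernel_closed MV E\<^sub>X \<longleftrightarrow> cokernel_closed YY E\<^sub>Y \<and> cokernel_closed ZZ E\<^sub>Z"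
proof
  obtain N N' where N: "N \<in> E\<^sub>Y" "zero_object YY N" and N': "N' \<in> E\<^sub>Z" "zero_object ZZ N'"
    by (rule zero_objects)
  assume X: "cokernel_closed MV E\<^sub>X"
  have "Cod YY q \<in> E\<^sub>Y" if "is_cokernel YY q f" "Dom YY f \<in> E\<^sub>Y" "Cod YY f \<in> E\<^sub>Y" for f q
    using X[unfolded cokernel_closed_def, rule_format, of "embY N' q" "embY N' f"] that
      is_cokernel_embY[OF N'(2)] embY_Obj_E\<^sub>X[OF N'(1)] by simp
  moreover have "Cod ZZ q \<in> E\<^sub>Z" if "is_cokernel ZZ q f" "Dom ZZ f \<in> E\<^sub>Z" "Cod ZZ f \<in> E\<^sub>Z" for f q
    using X[unfolded cokernel_closed_def, rule_format, of "embZ N q" "embZ N f"] that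
      is_cokernel_embZ[OF N(2)] embZ_Obj_E\<^sub>X[OF N(1)] by simp
  ultimately show "cokernel_closed YY E\<^sub>Y \<and> cokernel_closed ZZ E\<^sub>Z"
    unfolding cokernel_closed_def by blast
next
  assume YZ: "cokernel_closed YY E\<^sub>Y \<and> cokernel_closed ZZ E\<^sub>Z"
  have "Cod MV m \<in> E\<^sub>X" if "is_cokernel MV m n" and E: "Dom MV n \<in> E\<^sub>X" "Cod MV n \<in> E\<^sub>X" for m n
    using that(1)
  proof (cases rule: is_cokernel_MV_cases)
    case (1 A\<^sub>Z A\<^sub>Y a B\<^sub>Z B\<^sub>Y b Q\<^sub>Z Q\<^sub>Y c q r z y)
    then show ?thesis
      using E YZ[unfolded cokernel_closed_def] E\<^sub>X_if_Arr[OF 1(5)] E\<^sub>X_if_Arr[OF 1(6)]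
      by (metis MV_Cod MV_Dom)
  qed
  then show "cokernel_closed MV E\<^sub>X"
    unfolding cokernel_closed_def by blast
qed

lemma subobject_closed_MV:
  "subobject_closed MV E\<^sub>X \<longleftrightarrow> subobject_closed YY E\<^sub>Y \<and> subobject_closed ZZ E\<^sub>Z"
proof
  obtain N N' where N: "N \<in> E\<^sub>Y" "zero_object YY N" and N': "N' \<in> E\<^sub>Z" "zero_object ZZ N'"
    by (rule zero_objects)
  assume X: "subobject_closed MV E\<^sub>X"
  have "Dom YY f \<in> E\<^sub>Y" if "monic YY f" "Cod YY f \<in> E\<^sub>Y" for f
    using X[unfolded subobject_closed_def, rule_format, of "embY N' f"] that
      monic_embY[OF N'(2)] embY_Obj_E\<^sub>X[OF N'(1)] by (simp add: monic_def[of YY])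
  moreover have "Dom ZZ f \<in> E\<^sub>Z" if "monic ZZ f" "Cod ZZ f \<in> E\<^sub>Z" for f
    using X[unfolded subobject_closed_def, rule_format, of "embZ N f"] that
      monic_embZ[OF N(2)] embZ_Obj_E\<^sub>X[OF N(1)] by (simp add: monic_def[of ZZ])
  ultimately show "subobject_closed YY E\<^sub>Y \<and> subobject_closed ZZ E\<^sub>Z"
    unfolding subobject_closed_def by blast
next
  assume YZ: "subobject_closed YY E\<^sub>Y \<and> subobject_closed ZZ E\<^sub>Z"
  have "Dom MV m \<in> E\<^sub>X" if "monic MV m" and E: "Cod MV m \<in> E\<^sub>X" for m
  proof -
    have arr: "m \<in> Arr MV" using that(1) by (simp add: monic_def)
    then obtain A\<^sub>Z A\<^sub>Y a B\<^sub>Z B\<^sub>Y b z y where m: "m = ((A\<^sub>Z, A\<^sub>Y, a), (B\<^sub>Z, B\<^sub>Y, b), z, y)"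
      by (rule MV_Arr_cases)
    show ?thesis
      using YZ[unfolded subobject_closed_def] MV_monic_iff[OF arr[unfolded m]] that
        E\<^sub>X_if_Arr[OF arr[unfolded m]] unfolding m by (metis MV_Cod MV_Dom)
  qed
  then show "subobject_closed MV E\<^sub>X"
    unfolding subobject_closed_def by blast
qed

section \<open>Simple objects and the left Schur property\<close>

text \<open>In a short exact sequence with this middle term, the Y-components of the ends are a
  subobject and a quotient of \<open>N\<close>, hence zero. Whether the ends vanish is thus decided
  by their Z-components alone.\<close>

lemma simple_in_embZ_Obj:
  assumes "N \<in> E\<^sub>Y" "zero_object YY N"
  shows "simple_in MV E\<^sub>X (embZ_Obj N Z) \<longleftrightarrow> simple_in ZZ E\<^sub>Z Z"
proof
  assume X: "simple_in MV E\<^sub>X (embZ_Obj N Z)"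
  have False if "short_exact ZZ f g" "Cod ZZ f = Z" "Dom ZZ f \<in> E\<^sub>Z" "Cod ZZ g \<in> E\<^sub>Z"
    "\<not> zero_object ZZ (Dom ZZ f)" "\<not> zero_object ZZ (Cod ZZ g)" for f g
  proof -
    have "short_exact MV (embZ N f) (embZ N g)" "Cod MV (embZ N f) = embZ_Obj N Z"
      "Dom MV (embZ N f) \<in> E\<^sub>X" "Cod MV (embZ N g) \<in> E\<^sub>X"
      "\<not> zero_object MV (Dom MV (embZ N f))" "\<not> zero_object MV (Cod MV (embZ N g))"
      using that short_exact_embZ[OF assms(2)] embZ_Obj_E\<^sub>X[OF assms(1)]
        zero_object_embZ_Obj[OF assms(2)] by simp_all
    with X show False
      unfolding simple_in_def by blast
  qed
  then show "simple_in ZZ E\<^sub>Z Z"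
    using X embZ_Obj_E\<^sub>X[OF assms(1)] zero_object_embZ_Obj[OF assms(2)]
    unfolding simple_in_def by blast
next
  assume Z: "simple_in ZZ E\<^sub>Z Z"
  have False if "short_exact MV m n" and that': "Cod MV m = embZ_Obj N Z" "Dom MV m \<in> E\<^sub>X"
    "Cod MV n \<in> E\<^sub>X" "\<not> zero_object MV (Dom MV m)" "\<not> zero_object MV (Cod MV n)" for m n
    using that(1)
  proof (cases rule: short_exact_MV_cases)
    case (1 L\<^sub>Z L\<^sub>Y c M\<^sub>Z M\<^sub>Y a R\<^sub>Z R\<^sub>Y b f\<^sub>Z f\<^sub>Y g\<^sub>Z g\<^sub>Y)
    have M: "M\<^sub>Z = Z" "M\<^sub>Y = N"
      using that'(1) 1(1) by (auto simp: embZ_Obj_def)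
    have f: "f\<^sub>Y \<in> Hom YY L\<^sub>Y N" and g: "g\<^sub>Y \<in> Hom YY N R\<^sub>Y"
      and c: "c \<in> Hom YY (FObj F L\<^sub>Z) L\<^sub>Y" and b: "b \<in> Hom YY (FObj F R\<^sub>Z) R\<^sub>Y"
      using 1(5,6) M by (auto simp: MV_Arr_iff)
    have "zero_object YY L\<^sub>Y"
      using Y.zero_object_if_monic[OF Y.is_kernel_monic f assms(2)] 1(4) by (auto simp: short_exact_def)
    moreover have "zero_object YY R\<^sub>Y"
      using Y.zero_object_if_epic[OF Y.is_cokernel_epic g assms(2)] 1(4) by (auto simp: short_exact_def)
    ultimately have "\<not> zero_object ZZ L\<^sub>Z" "\<not> zero_object ZZ R\<^sub>Z"
      using that'(4,5) b c 1(1,2) by (auto simp: MV_zero_object_iff)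
    then show False
      using Z that' 1 M E\<^sub>X_if_Arr[OF 1(5)] E\<^sub>X_if_Arr[OF 1(6)] unfolding simple_in_def
      by (metis MV_Cod MV_Dom)
  qed
  then show "simple_in MV E\<^sub>X (embZ_Obj N Z)"
    using Z embZ_Obj_E\<^sub>X[OF assms(1)] zero_object_embZ_Obj[OF assms(2)]
    unfolding simple_in_def by blast
qed

lemma simple_in_embY_Obj:
  assumes "N \<in> E\<^sub>Z" "zero_object ZZ N"
  shows "simple_in MV E\<^sub>X (embY_Obj N Y) \<longleftrightarrow> simple_in YY E\<^sub>Y Y"
proof
  assume X: "simple_in MV E\<^sub>X (embY_Obj N Y)"
  have False if "short_exact YY f g" "Cod YY f = Y" "Dom YY f \<in> E\<^sub>Y" "Cod YY g \<in> E\<^sub>Y"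
    "\<not> zero_object YY (Dom YY f)" "\<not> zero_object YY (Cod YY g)" for f g
  proof -
    have "short_exact MV (embY N f) (embY N g)" "Cod MV (embY N f) = embY_Obj N Y"
      "Dom MV (embY N f) \<in> E\<^sub>X" "Cod MV (embY N g) \<in> E\<^sub>X"
      "\<not> zero_object MV (Dom MV (embY N f))" "\<not> zero_object MV (Cod MV (embY N g))"
      using that short_exact_embY[OF assms(2)] embY_Obj_E\<^sub>X[OF assms(1)]
        zero_object_embY_Obj[OF assms(2)] by simp_all
    with X show False
      unfolding simple_in_def by blast
  qed
  then show "simple_in YY E\<^sub>Y Y"
    using X embY_Obj_E\<^sub>X[OF assms(1)] zero_object_embY_Obj[OF assms(2)]
    unfolding simple_in_def by blast
next
  assume Y: "simple_in YY E\<^sub>Y Y"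
  have False if "short_exact MV m n" and that': "Cod MV m = embY_Obj N Y" "Dom MV m \<in> E\<^sub>X"
    "Cod MV n \<in> E\<^sub>X" "\<not> zero_object MV (Dom MV m)" "\<not> zero_object MV (Cod MV n)" for m n
    using that(1)
  proof (cases rule: short_exact_MV_cases)
    case (1 L\<^sub>Z L\<^sub>Y c M\<^sub>Z M\<^sub>Y a R\<^sub>Z R\<^sub>Y b f\<^sub>Z f\<^sub>Y g\<^sub>Z g\<^sub>Y)
    have M: "M\<^sub>Z = N" "M\<^sub>Y = Y"
      using that'(1) 1(1) by (auto simp: embY_Obj_def)
    have f: "f\<^sub>Z \<in> Hom ZZ L\<^sub>Z N" and g: "g\<^sub>Z \<in> Hom ZZ N R\<^sub>Z"
      and c: "c \<in> Hom YY (FObj F L\<^sub>Z) L\<^sub>Y" and b: "b \<in> Hom YY (FObj F R\<^sub>Z) R\<^sub>Y"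
      using 1(5,6) M by (auto simp: MV_Arr_iff)
    have "zero_object ZZ L\<^sub>Z"
      using Z.zero_object_if_monic[OF Z.is_kernel_monic f assms(2)] 1(3) by (auto simp: short_exact_def)
    moreover have "zero_object ZZ R\<^sub>Z"
      using Z.zero_object_if_epic[OF Z.is_cokernel_epic g assms(2)] 1(3) by (auto simp: short_exact_def)
    ultimately have "\<not> zero_object YY L\<^sub>Y" "\<not> zero_object YY R\<^sub>Y"
      using that'(4,5) b c 1(1,2) by (auto simp: MV_zero_object_iff)
    then show False
      using Y that' 1 M E\<^sub>X_if_Arr[OF 1(5)] E\<^sub>X_if_Arr[OF 1(6)] unfolding simple_in_def
      by (metis MV_Cod MV_Dom)
  qed
  then show "simple_in MV E\<^sub>X (embY_Obj N Y)"
    using Y embY_Obj_E\<^sub>X[OF assms(1)] zero_object_embY_Obj[OF assms(2)]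
    unfolding simple_in_def by blast
qed

text \<open>Targets are arbitrary triples in \<open>E\<^sub>X\<close>, not just embedded ones. The
  Y-component of an arrow to such a target starts at a zero object and is therefore both zero and
  monic, so the Z-component alone decides the alternative.\<close>

lemma left_Schurian_embZ_Obj:
  assumes "N \<in> E\<^sub>Y" "zero_object YY N" "Z \<in> Obj ZZ"
  shows "left_Schurian MV E\<^sub>X (embZ_Obj N Z) \<longleftrightarrow> left_Schurian ZZ E\<^sub>Z Z"
proof
  assume X: "left_Schurian MV E\<^sub>X (embZ_Obj N Z)"
  have "f = Zero ZZ Z A \<or> monic ZZ f" if "A \<in> E\<^sub>Z" and f: "f \<in> Hom ZZ Z A" for A f
  proof -
    have "embZ N f = Zero MV (embZ_Obj N Z) (embZ_Obj N A) \<or> monic MV (embZ N f)"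
      using X that embZ_in[OF assms(2) f] embZ_Obj_E\<^sub>X[OF assms(1)] unfolding left_Schurian_def by blast
    then show ?thesis
      using monic_embZ[OF assms(2) Hom_Arr[OF f]] by (auto simp: embZ_def embZ_Obj_def)
  qed
  then show "left_Schurian ZZ E\<^sub>Z Z"
    using X assms(3) zero_object_embZ_Obj[OF assms(2)] unfolding left_Schurian_def by blast
next
  assume Z: "left_Schurian ZZ E\<^sub>Z Z"
  have N: "N \<in> Obj YY"
    using assms(2) by (simp add: zero_object_def)
  have "m = Zero MV (embZ_Obj N Z) S \<or> monic MV m"
    if S: "S \<in> E\<^sub>X" and m: "m \<in> Hom MV (embZ_Obj N Z) S" for S m
  proof -
    obtain A\<^sub>Z A\<^sub>Y a where S': "S = (A\<^sub>Z, A\<^sub>Y, a)" by (metis prod_cases3)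
    obtain z y where m': "m = (embZ_Obj N Z, S, z, y)" and arr: "(embZ_Obj N Z, S, z, y) \<in> Arr MV"
      using m unfolding MV_Hom_iff by blast
    have z: "z \<in> Hom ZZ Z A\<^sub>Z" and y: "y \<in> Hom YY N A\<^sub>Y"
      using arr by (auto simp: S' embZ_Obj_def MV_Arr_iff)
    have "y = Zero YY N A\<^sub>Y" "monic YY y"
      using Y.zero_object_Hom_eqI[OF _ y Y.Zero_in] assms(2) Y.Hom_Obj[OF y]
        Y.monic_if_zero_object[OF _ y] by auto
    moreover have "z = Zero ZZ Z A\<^sub>Z \<or> monic ZZ z"
      using Z z S unfolding S' E\<^sub>X_iff left_Schurian_def by blast
    ultimately show ?thesis
      using MV_monic_iff[OF arr[unfolded S' embZ_Obj_def]] by (auto simp: m' S' embZ_Obj_def)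
  qed
  moreover have "embZ_Obj N Z \<in> Obj MV"
    using assms(3) N FObj_in by (simp add: embZ_Obj_def MV_Obj_iff)
  ultimately show "left_Schurian MV E\<^sub>X (embZ_Obj N Z)"
    using Z zero_object_embZ_Obj[OF assms(2)] unfolding left_Schurian_def by blast
qed

lemma left_Schurian_embY_Obj:
  assumes "N \<in> E\<^sub>Z" "zero_object ZZ N" "Y \<in> Obj YY"
  shows "left_Schurian MV E\<^sub>X (embY_Obj N Y) \<longleftrightarrow> left_Schurian YY E\<^sub>Y Y"
proof
  assume X: "left_Schurian MV E\<^sub>X (embY_Obj N Y)"
  have "f = Zero YY Y A \<or> monic YY f" if "A \<in> E\<^sub>Y" and f: "f \<in> Hom YY Y A" for A f
  proof -
    have "embY N f = Zero MV (embY_Obj N Y) (embY_Obj N A) \<or> monic MV (embY N f)"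
      using X that embY_in[OF assms(2) f] embY_Obj_E\<^sub>X[OF assms(1)] unfolding left_Schurian_def by blast
    then show ?thesis
      using monic_embY[OF assms(2) Hom_Arr[OF f]] by (auto simp: embY_def embY_Obj_def)
  qed
  then show "left_Schurian YY E\<^sub>Y Y"
    using X assms(3) zero_object_embY_Obj[OF assms(2)] unfolding left_Schurian_def by blast
next
  assume Y: "left_Schurian YY E\<^sub>Y Y"
  have N: "N \<in> Obj ZZ"
    using assms(2) by (simp add: zero_object_def)
  have "m = Zero MV (embY_Obj N Y) S \<or> monic MV m"
    if S: "S \<in> E\<^sub>X" and m: "m \<in> Hom MV (embY_Obj N Y) S" for S m
  proof -
    obtain A\<^sub>Z A\<^sub>Y a where S': "S = (A\<^sub>Z, A\<^sub>Y, a)" by (metis prod_cases3)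
    obtain z y where m': "m = (embY_Obj N Y, S, z, y)" and arr: "(embY_Obj N Y, S, z, y) \<in> Arr MV"
      using m unfolding MV_Hom_iff by blast
    have z: "z \<in> Hom ZZ N A\<^sub>Z" and y: "y \<in> Hom YY Y A\<^sub>Y"
      using arr by (auto simp: S' embY_Obj_def MV_Arr_iff)
    have "z = Zero ZZ N A\<^sub>Z" "monic ZZ z"
      using Z.zero_object_Hom_eqI[OF _ z Z.Zero_in] assms(2) Z.Hom_Obj[OF z]
        Z.monic_if_zero_object[OF _ z] by auto
    moreover have "y = Zero YY Y A\<^sub>Y \<or> monic YY y"
      using Y y S unfolding S' E\<^sub>X_iff left_Schurian_def by blast
    ultimately show ?thesis
      using MV_monic_iff[OF arr[unfolded S' embY_Obj_def]] by (auto simp: m' S' embY_Obj_def)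
  qed
  moreover have "embY_Obj N Y \<in> Obj MV"
    using assms(3) N FObj_in by (simp add: embY_Obj_def MV_Obj_iff)
  ultimately show "left_Schurian MV E\<^sub>X (embY_Obj N Y)"
    using Y zero_object_embY_Obj[OF assms(2)] unfolding left_Schurian_def by blast
qed

lemma simple_in_MV_cases:
  assumes "simple_in MV E\<^sub>X M"
  obtains (Z) N Z where "N \<in> E\<^sub>Y" "zero_object YY N" "M = embZ_Obj N Z"
  | (Y) N Y where "N \<in> E\<^sub>Z" "zero_object ZZ N" "M = embY_Obj N Y"
proof -
  obtain N N' where N: "N \<in> E\<^sub>Y" "zero_object YY N" and N': "N' \<in> E\<^sub>Z" "zero_object ZZ N'"
    by (rule zero_objects)
  obtain Z Y f where M: "M = (Z, Y, f)" by (metis prod_cases3)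
  have f: "f \<in> Hom YY (FObj F Z) Y" and ZY: "Z \<in> E\<^sub>Z" "Y \<in> E\<^sub>Y"
    using assms by (auto simp: M E\<^sub>X_iff simple_in_def)
  have obj: "Z \<in> Obj ZZ" "Y \<in> Obj YY"
    using ZY sub_Obj by auto
  let ?i = "(embY_Obj N' Y, (Z, Y, f), Zero ZZ N' Z, Id YY Y)"
    and ?p = "((Z, Y, f), embZ_Obj N Z, Id ZZ Z, Zero YY Y N)"
  \<comment> \<open>Both ends belong to \<open>E\<^sub>X\<close> because \<open>N\<close> and
    \<open>N'\<close> come from the subcategories, so simplicity applies to this sequence.\<close>
  have "short_exact MV ?i ?p" "Cod MV ?i = M" "Dom MV ?i \<in> E\<^sub>X" "Cod MV ?p \<in> E\<^sub>X"
    using short_exact_MV_split[OF f obj(1) N(2) N'(2)] ZY M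
      embZ_Obj_E\<^sub>X[OF N(1)] embY_Obj_E\<^sub>X[OF N'(1)] by simp_all
  with assms have "zero_object MV (embY_Obj N' Y) \<or> zero_object MV (embZ_Obj N Z)"
    unfolding simple_in_def by (metis MV_Cod MV_Dom)
  then consider "zero_object YY Y" | "zero_object ZZ Z"
    using zero_object_embY_Obj[OF N'(2)] zero_object_embZ_Obj[OF N(2)] by blast
  then show thesis
  proof cases
    case 1
    then have "f = Zero YY (FObj F Z) Y"
      using Y.zero_object_Hom_eqI f Y.Zero_in FObj_in[OF obj(1)] obj(2) by blast
    \<comment> \<open>The zero object \<open>Y\<close> itself serves as the parameter of the
      embedding, which makes \<open>M\<close> equal to an embedded object.\<close>
    then show thesis
      using Z[of Y Z] 1 ZY M by (simp add: embZ_Obj_def)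
  next
    case 2
    \<comment> \<open>Here the source of \<open>f\<close> vanishes: \<open>F\<close> preserves zero
      objects, so \<open>FObj F Z\<close> is zero.\<close>
    then have "f = Zero YY (FObj F Z) Y"
      using Y.zero_object_Hom_eqI zero_object_FObj f Y.Zero_in FObj_in[OF obj(1)] obj(2) by blast
    then show thesis
      using Y[of Z Y] 2 ZY M by (simp add: embY_Obj_def)
  qed
qed

text \<open>For embedded objects, being simple and being left Schurian are equivalent to the same
  properties in the component; \<open>simple_in_MV_cases\<close> ensures that
  \<open>E\<^sub>X\<close> has no other simple objects.\<close>

lemma left_Schur_MV: "left_Schur MV E\<^sub>X \<longleftrightarrow> left_Schur YY E\<^sub>Y \<and> left_Schur ZZ E\<^sub>Z"
proof
  obtain N N' where N: "N \<in> E\<^sub>Y" "zero_object YY N" and N': "N' \<in> E\<^sub>Z" "zero_object ZZ N'"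
    by (rule zero_objects)
  assume X: "left_Schur MV E\<^sub>X"
  have "left_Schurian YY E\<^sub>Y Y" if "simple_in YY E\<^sub>Y Y" for Y
  proof -
    have "Y \<in> Obj YY"
      using that sub_Obj by (auto simp: simple_in_def)
    moreover have "left_Schurian MV E\<^sub>X (embY_Obj N' Y)"
      using X that simple_in_embY_Obj[OF N'] unfolding left_Schur_def by blast
    ultimately show ?thesis
      using left_Schurian_embY_Obj[OF N'] by blast
  qed
  moreover have "left_Schurian ZZ E\<^sub>Z Z" if "simple_in ZZ E\<^sub>Z Z" for Z
  proof -
    have "Z \<in> Obj ZZ"
      using that sub_Obj by (auto simp: simple_in_def)
    moreover have "left_Schurian MV E\<^sub>X (embZ_Obj N Z)"
      using X that simple_in_embZ_Obj[OF N] unfolding left_Schur_def by blast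
    ultimately show ?thesis
      using left_Schurian_embZ_Obj[OF N] by blast
  qed
  ultimately show "left_Schur YY E\<^sub>Y \<and> left_Schur ZZ E\<^sub>Z"
    using X extension_closed_MV by (simp add: left_Schur_def)
next
  assume YZ: "left_Schur YY E\<^sub>Y \<and> left_Schur ZZ E\<^sub>Z"
  have "left_Schurian MV E\<^sub>X M" if M: "simple_in MV E\<^sub>X M" for M
    using M
  proof (cases rule: simple_in_MV_cases)
    case (Z N Z)
    with M have "simple_in ZZ E\<^sub>Z Z"
      using simple_in_embZ_Obj by simp
    then show ?thesis
      using YZ Z left_Schurian_embZ_Obj[OF Z(1,2)] by (simp add: left_Schur_def left_Schurian_def[of ZZ])
  next
    case (Y N Y)
    with M have "simple_in YY E\<^sub>Y Y"
      using simple_in_embY_Obj by simp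
    then show ?thesis
      using YZ Y left_Schurian_embY_Obj[OF Y(1,2)] by (simp add: left_Schur_def left_Schurian_def[of YY])
  qed
  then show "left_Schur MV E\<^sub>X"
    using YZ extension_closed_MV by (simp add: left_Schur_def)
qed

end

theorem corollary4p2:
  fixes YY :: "('o, 'a) precat" and ZZ :: "('p, 'b) precat"
    and F :: "('p, 'b, 'o, 'a) cfunctor"
    and E\<^sub>Y :: "'o set" and E\<^sub>Z :: "'p set"
  assumes "length_abelian_category YY" and "length_abelian_category ZZ"
    and "right_exact_functor ZZ YY F"
    and "subcategory YY E\<^sub>Y" and "subcategory ZZ E\<^sub>Z"
  shows "(left_Schur YY E\<^sub>Y \<and> left_Schur ZZ E\<^sub>Z \<longleftrightarrow>
            left_Schur (MV_category YY ZZ F) (MV_sub YY ZZ F E\<^sub>Y E\<^sub>Z)) \<and>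
         (wide YY E\<^sub>Y \<and> wide ZZ E\<^sub>Z \<longleftrightarrow>
            wide (MV_category YY ZZ F) (MV_sub YY ZZ F E\<^sub>Y E\<^sub>Z)) \<and>
         (torsion_free YY E\<^sub>Y \<and> torsion_free ZZ E\<^sub>Z \<longleftrightarrow>
            torsion_free (MV_category YY ZZ F) (MV_sub YY ZZ F E\<^sub>Y E\<^sub>Z))"
proof -
  interpret macpherson_vilonen_sub ZZ YY F E\<^sub>Y E\<^sub>Z
    using assms
    by (simp add: macpherson_vilonen_sub_def macpherson_vilonen_sub_axioms_def
        macpherson_vilonen_def length_abelian_category_def)
  show ?thesis
    unfolding wide_def torsion_free_def
    using left_Schur_MV extension_closed_MV kernel_closed_MV cokernel_closed_MV subobject_closed_MV
    by blast
qed

end
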